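(* (i) For every integer $r\ge 4$ there exist $n_0(r)$ and $\beta_r>0$ such that for every $n\ge n_0(r)$ there is a linear $r$-uniform hypergraph $\mathcal F$ on $n$ vertices which contains neither $r\times r$ grids nor triangles and has $$|\mathcal F| > n^2 e^{-\beta_r\sqrt{\log n}}.$$ In addition, if $r$ divides $n$, then such an $\mathcal F$ can be chosen so that its edge set can be decomposed into perfect matchings; in particular it is regular. (ii) For $r=3$ the same holds with a weaker lower bound: there exist $n_0(3)$ and $\beta_3>0$ such that for every $n\ge n_0(3)$ there is a linear $3$-uniform hypergraph $\mathcal F$ on $n$ vertices containing neither $3\times 3$ grids nor triangles and with $$|\mathcal F| > n^{1.6} e^{-\beta_3\sqrt{\log n}},$$ and if $3$ divides $n$, then such an $\mathcal F$ can be chosen to be decomposable into perfect matchings.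
   Context: A hypergraph is identified with its set of edges $\mathcal F$. It is $r$-uniform if every edge has exactly $r$ elements, linear if $|A\cap B|\le 1$ for all distinct edges $A,B$, and regular if all vertices lie in the same number of edges. An $r\times r$ grid in an $r$-uniform hypergraph consists of $2r$ distinct edges $A_1,\dots,A_r,B_1,\dots,B_r$ with $A_i\cap A_j=B_i\cap B_j=\emptyset$ for $1\le i<j\le r$ and $|A_i\cap B_j|=1$ for all $1\le i,j\le r$. A triangle consists of three edges $C_1,C_2,C_3$ that pairwise intersect in three distinct singletons: $|C_1\cap C_2|=|C_2\cap C_3|=|C_3\cap C_1|=1$ and $C_1\cap C_2\ne C_1\cap C_3$. A perfect matching is a subfamily of edges covering every vertex exactly once. *)

theory Defs
  imports Complex_Main "HOL-Library.Disjoint_Sets"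
begin

(* A hypergraph is its set of edges F.  The vertex set V is carried along explicitly, so that
   isolated vertices count. *)
definition hypergraph_on :: "'a set \<Rightarrow> 'a set set \<Rightarrow> bool" where
  "hypergraph_on V F \<longleftrightarrow> finite V \<and> (\<forall>A\<in>F. A \<subseteq> V)"

definition uniform_hypergraph :: "nat \<Rightarrow> 'a set set \<Rightarrow> bool" where
  "uniform_hypergraph r F \<longleftrightarrow> (\<forall>A\<in>F. finite A \<and> card A = r)"

definition linear_hypergraph :: "'a set set \<Rightarrow> bool" where
  "linear_hypergraph F \<longleftrightarrow> (\<forall>A\<in>F. \<forall>B\<in>F. A \<noteq> B \<longrightarrow> card (A \<inter> B) \<le> 1)"

definition regular_hypergraph :: "'a set \<Rightarrow> 'a set set \<Rightarrow> bool" where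
  "regular_hypergraph V F \<longleftrightarrow> (\<exists>d. \<forall>v\<in>V. card {A\<in>F. v \<in> A} = d)"

(* The first three conjuncts say that the 2r edges are distinct. *)
definition is_grid :: "nat \<Rightarrow> (nat \<Rightarrow> 'a set) \<Rightarrow> (nat \<Rightarrow> 'a set) \<Rightarrow> bool" where
  "is_grid r A B \<longleftrightarrow>
     inj_on A {1..r} \<and> inj_on B {1..r} \<and> A ` {1..r} \<inter> B ` {1..r} = {} \<and>
     (\<forall>i\<in>{1..r}. \<forall>j\<in>{1..r}. i < j \<longrightarrow> A i \<inter> A j = {} \<and> B i \<inter> B j = {}) \<and>
     (\<forall>i\<in>{1..r}. \<forall>j\<in>{1..r}. card (A i \<inter> B j) = 1)"

definition contains_grid :: "nat \<Rightarrow> 'a set set \<Rightarrow> bool" where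
  "contains_grid r F \<longleftrightarrow>
     (\<exists>A B. A ` {1..r} \<subseteq> F \<and> B ` {1..r} \<subseteq> F \<and> is_grid r A B)"

definition is_triangle :: "'a set \<Rightarrow> 'a set \<Rightarrow> 'a set \<Rightarrow> bool" where
  "is_triangle C1 C2 C3 \<longleftrightarrow>
     C1 \<noteq> C2 \<and> C2 \<noteq> C3 \<and> C3 \<noteq> C1 \<and>
     card (C1 \<inter> C2) = 1 \<and> card (C2 \<inter> C3) = 1 \<and> card (C3 \<inter> C1) = 1 \<and>
     C1 \<inter> C2 \<noteq> C1 \<inter> C3"

definition contains_triangle :: "'a set set \<Rightarrow> bool" where
  "contains_triangle F \<longleftrightarrow> (\<exists>C1\<in>F. \<exists>C2\<in>F. \<exists>C3\<in>F. is_triangle C1 C2 C3)"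

definition perfect_matching :: "'a set \<Rightarrow> 'a set set \<Rightarrow> 'a set set \<Rightarrow> bool" where
  "perfect_matching V F M \<longleftrightarrow> M \<subseteq> F \<and> (\<forall>v\<in>V. \<exists>!A. A \<in> M \<and> v \<in> A)"

definition decomposable_into_perfect_matchings :: "'a set \<Rightarrow> 'a set set \<Rightarrow> bool" where
  "decomposable_into_perfect_matchings V F \<longleftrightarrow>
     (\<exists>\<M>. partition_on F \<M> \<and> (\<forall>M\<in>\<M>. perfect_matching V F M))"

definition linear_grid_triangle_free :: "nat \<Rightarrow> 'a set \<Rightarrow> 'a set set \<Rightarrow> bool" where
  "linear_grid_triangle_free r V F \<longleftrightarrow>
     hypergraph_on V F \<and> uniform_hypergraph r F \<and> linear_hypergraph F \<and>
     \<not> contains_grid r F \<and> \<not> contains_triangle F"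

end

theory Submission
  imports Defs "HOL-Library.FuncSet"
begin

text \<open>
  The hypergraph consists of \<^emph>\<open>uniform motions\<close>. Take \<open>r\<close> disjoint copies of \<open>\<int>/m\<close>, the \<open>k\<close>-th one
  being thought of as a snapshot at time \<open>c\<^sub>k\<close>, where \<open>c\<^sub>0 < c\<^sub>1 < \<dots>\<close> are fixed integers. A particle that
  starts at \<open>x \<in> \<int>/m\<close> and has velocity \<open>a\<close> is the edge which contains the point \<open>x + c\<^sub>k a\<close> of every
  copy \<open>k\<close>. All starting points are admitted, but only velocities \<open>a\<close> from a set \<open>S\<close> of integers that
  are small compared to \<open>m\<close>. Two edges share a vertex if and only if the particles meet in a snapshot.
  For a fixed velocity the particles occupy every vertex exactly once, so the edge set splits into
  \<open>|S|\<close> perfect matchings; as velocities are small, two distinct particles meet at most once, so the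
  hypergraph is linear with \<open>m |S|\<close> edges. It remains to choose a large \<open>S\<close>.

  \<^emph>\<open>Triangles.\<close> Three particles that meet pairwise at three different times have velocities satisfying
  \<open>p a + q b = (p + q) c\<close> with positive \<open>p\<close> and \<open>q\<close> bounded in terms of \<open>r\<close>. Behrend's sphere construction
  (\<open>dense_convex_solution_free_set\<close>) gives a set of \<open>M e\<^bsup>-O(\<surd>log M)\<^esup>\<close> integers below \<open>M\<close> in which such an
  equation forces \<open>a = b = c\<close>.

  \<^emph>\<open>Grids.\<close> Small velocities allow the \<open>2r\<close> particles of a grid to be lifted from \<open>\<int>/m\<close> to \<open>\<int>\<close>. The lifted
  particles form two classes of size \<open>r\<close>; in each of the \<open>r\<close> snapshots every particle sits together with
  exactly one particle of the other class. Draw the particle \<open>(x, a)\<close> as a point of the plane. In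
  each of \<open>r\<close> directions the two extreme lines carry two points each, so the \<open>2r\<close> points are the
  vertices of a convex \<open>2r\<close>-gon whose vertices alternate between the classes, and inspection of the
  next levels shows that, on both sides of an edge, the next two vertices and the two after these span
  chords parallel to the edge. This is what \<open>alternating_chain\<close> extracts for six consecutive
  vertices. For \<open>r \<ge> 4\<close> these parallelisms impose a relation between the times \<open>c\<^sub>k\<close>, which is violated by a suitable
  choice of times: there are no grids, whatever \<open>S\<close> is. For \<open>r = 3\<close> the polygon is a hexagon and such
  hexagons do exist, but their velocities form a pattern of six numbers with three degrees of freedom
  (\<open>integer_grid_rigid\<close>). There are at most \<open>M\<^sup>3\<close> such patterns below \<open>M\<close>, and deleting them from a random subset of
  density \<open>M\<^bsup>-2/5-o(1)\<^esup>\<close> of the Behrend set leaves \<open>M\<^bsup>3/5-o(1)\<^esup>\<close> velocities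
  (\<open>dense_hexagon_free_set\<close>), whence the exponent \<open>1.6\<close>.
\<close>

section \<open>Dense sets without weighted averages\<close>

lemma pigeonhole_fibre:
  fixes f :: "'a \<Rightarrow> nat"
  assumes "finite X" and "0 < q" and "\<And>x. x \<in> X \<Longrightarrow> f x < q"
  shows "\<exists>c<q. card X \<le> q * card {x\<in>X. f x = c}"
proof (rule ccontr)
  assume "\<not> ?thesis"
  then have small: "q * card {x\<in>X. f x = c} < card X" if "c < q" for c
    using that by auto
  have "card X = (\<Sum>c<q. card {x\<in>X. f x = c})"
  proof -
    have "X = (\<Union>c<q. {x\<in>X. f x = c})" using assms(3) by auto
    also have "card \<dots> = (\<Sum>c<q. card {x\<in>X. f x = c})"
      by (rule card_UN_disjoint) (use assms(1) in auto)
    finally show ?thesis .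
  qed
  then have "q * card X = (\<Sum>c<q. q * card {x\<in>X. f x = c})"
    by (simp add: sum_distrib_left)
  also have "\<dots> < (\<Sum>c<q. card X)"
    by (rule sum_strict_mono) (use small assms(2) in auto)
  finally show False by simp
qed

text \<open>
  No element of \<open>S\<close> is a proper convex combination of two different elements of \<open>S\<close> with integer
  weights of total at most \<open>L\<close>; for \<open>L = 2\<close> this excludes three-term arithmetic progressions.
\<close>

definition convex_solution_free :: "nat \<Rightarrow> nat set \<Rightarrow> bool" where
  "convex_solution_free L S \<longleftrightarrow>
     (\<forall>p q. 0 < p \<longrightarrow> 0 < q \<longrightarrow> p + q \<le> L \<longrightarrow>
       (\<forall>a\<in>S. \<forall>b\<in>S. \<forall>c\<in>S. p * a + q * b = (p + q) * c \<longrightarrow> a = b))"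

lemma digits_unique:
  fixes u v :: "nat \<Rightarrow> nat"
  assumes "\<And>i. i < d \<Longrightarrow> u i < B" and "\<And>i. i < d \<Longrightarrow> v i < B"
    and "(\<Sum>i<d. u i * B ^ i) = (\<Sum>i<d. v i * B ^ i)" and "i < d"
  shows "u i = v i"
  using assms
proof (induction d arbitrary: u v i)
  case 0
  then show ?case by simp
next
  case (Suc d)
  have shift: "(\<Sum>i<Suc d. w i * B ^ i) = w 0 + B * (\<Sum>i<d. w (Suc i) * B ^ i)" for w :: "nat \<Rightarrow> nat"
    by (subst sum.lessThan_Suc_shift) (simp add: sum_distrib_left mult_ac)
  have eq: "u 0 + B * (\<Sum>i<d. u (Suc i) * B ^ i) = v 0 + B * (\<Sum>i<d. v (Suc i) * B ^ i)"
    using Suc.prems(3) by (simp only: shift)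
  have lt: "u 0 < B" "v 0 < B" using Suc.prems(1,2) by auto
  have u0: "u 0 = v 0"
    using arg_cong[OF eq, of "\<lambda>z. z mod B"] lt by simp
  have tail: "(\<Sum>i<d. u (Suc i) * B ^ i) = (\<Sum>i<d. v (Suc i) * B ^ i)"
    using eq lt unfolding u0 by simp
  have "u (Suc j) = v (Suc j)" if "j < d" for j
    by (rule Suc.IH[OF _ _ tail that]) (use Suc.prems(1,2) in auto)
  then show ?case using u0 Suc.prems(4) by (cases i) auto
qed

lemma digits_less:
  fixes u :: "nat \<Rightarrow> nat"
  assumes "\<And>i. i < d \<Longrightarrow> u i < B"
  shows "(\<Sum>i<d. u i * B ^ i) < B ^ d"
  using assms
proof (induction d)
  case 0
  then show ?case by simp
next
  case (Suc d)
  have "(\<Sum>i<Suc d. u i * B ^ i) < B ^ d + u d * B ^ d" using Suc by simp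
  also have "\<dots> = Suc (u d) * B ^ d" by simp
  also have "\<dots> \<le> B * B ^ d" using Suc.prems[of d] by (intro mult_right_mono) auto
  finally show ?case by simp
qed

text \<open>
  Strict convexity of the ball. The reason is the identity
  \<open>p q (x - y)\<^sup>2 = (p + q) (p x\<^sup>2 + q y\<^sup>2) - (p x + q y)\<^sup>2\<close>, summed over the coordinates.
\<close>

lemma convex_combination_on_sphere:
  fixes x y z :: "nat \<Rightarrow> nat"
  assumes "0 < p" "0 < q"
    and comb: "\<And>i. i < d \<Longrightarrow> p * x i + q * y i = (p + q) * z i"
    and "(\<Sum>i<d. (x i)\<^sup>2) = R" "(\<Sum>i<d. (y i)\<^sup>2) = R" "(\<Sum>i<d. (z i)\<^sup>2) = R" and "i < d"
  shows "x i = y i"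
proof -
  let ?p = "int p" and ?q = "int q"
  have norm: "(\<Sum>i<d. (int (w i))\<^sup>2) = int (\<Sum>i<d. (w i)\<^sup>2)" for w :: "nat \<Rightarrow> nat"
    by simp
  have pt: "?p * ?q * (int (x i) - int (y i))\<^sup>2
      = (?p + ?q) * (?p * (int (x i))\<^sup>2 + ?q * (int (y i))\<^sup>2) - (?p + ?q)\<^sup>2 * (int (z i))\<^sup>2" if "i < d" for i
  proof -
    have c: "(?p * int (x i) + ?q * int (y i))\<^sup>2 = ((?p + ?q) * int (z i))\<^sup>2"
      using comb[OF that] by (metis of_nat_add of_nat_mult)
    have "?p * ?q * (int (x i) - int (y i))\<^sup>2
      = (?p + ?q) * (?p * (int (x i))\<^sup>2 + ?q * (int (y i))\<^sup>2) - (?p * int (x i) + ?q * int (y i))\<^sup>2"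
      by (simp add: algebra_simps power2_eq_square)
    then show ?thesis unfolding c by (simp add: power_mult_distrib)
  qed
  have "?p * ?q * (\<Sum>i<d. (int (x i) - int (y i))\<^sup>2)
     = (\<Sum>i<d. (?p + ?q) * (?p * (int (x i))\<^sup>2 + ?q * (int (y i))\<^sup>2) - (?p + ?q)\<^sup>2 * (int (z i))\<^sup>2)"
    using pt by (simp add: sum_distrib_left)
  also have "\<dots> = (?p + ?q) * (?p * (\<Sum>i<d. (int (x i))\<^sup>2) + ?q * (\<Sum>i<d. (int (y i))\<^sup>2))
      - (?p + ?q)\<^sup>2 * (\<Sum>i<d. (int (z i))\<^sup>2)"
    by (simp add: sum_distrib_left sum_subtractf sum.distrib distrib_left)
  also have "\<dots> = 0"
    unfolding norm assms(4-6) by (simp add: algebra_simps power2_eq_square)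
  finally have "(\<Sum>i<d. (int (x i) - int (y i))\<^sup>2) = 0"
    using assms(1,2) by simp
  then have "(int (x i) - int (y i))\<^sup>2 = 0"
    using \<open>i < d\<close> by (subst (asm) sum_nonneg_eq_0_iff) auto
  then show ?thesis by simp
qed

text \<open>
  Behrend's construction: numbers whose digits in base \<open>L D\<close> are below \<open>D\<close> and form a vector on a sphere.
  Since weights of total at most \<open>L\<close> cause no carry, an equation between the numbers is an equation
  between the digit vectors, and a sphere contains no proper convex combination of its points. The most popular
  among the \<open>d D\<^sup>2\<close> possible radii is taken.
\<close>

lemma sphere_set:
  fixes L D d :: nat
  assumes "0 < L" "0 < D" "0 < d"
  shows "\<exists>S \<subseteq> {..<(L * D) ^ d}. convex_solution_free L S \<and> D ^ d \<le> card S * (d * D\<^sup>2)"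
proof -
  define V where "V = {..<d} \<rightarrow>\<^sub>E {..<D}"
  define N where "N = (\<lambda>x :: nat \<Rightarrow> nat. \<Sum>i<d. (x i)\<^sup>2)"
  define val where "val = (\<lambda>x :: nat \<Rightarrow> nat. \<Sum>i<d. x i * (L * D) ^ i)"
  have finV: "finite V" unfolding V_def by (intro finite_PiE) auto
  have cardV: "card V = D ^ d" unfolding V_def by (subst card_PiE) auto
  have dig: "x i < D" if "x \<in> V" "i < d" for x i
    using that unfolding V_def by auto
  have digL: "x i < L * D" if "x \<in> V" "i < d" for x i
    using dig[OF that] assms(1) by (metis less_le_trans mult_le_mono1 mult_1 Suc_leI One_nat_def)
  have "N x < d * D\<^sup>2" if "x \<in> V" for x
  proof -
    have "N x < (\<Sum>i<d. D\<^sup>2)" unfolding N_def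
      using dig[OF that] assms(3) by (intro sum_strict_mono) (auto intro: power_strict_mono)
    then show ?thesis by simp
  qed
  then obtain R where R: "card V \<le> d * D\<^sup>2 * card {x\<in>V. N x = R}"
    using pigeonhole_fibre[OF finV, of "d * D\<^sup>2" N] assms by auto
  define W where "W = {x\<in>V. N x = R}"
  have inj: "inj_on val V"
  proof (rule inj_onI)
    fix x y assume xy: "x \<in> V" "y \<in> V" "val x = val y"
    have "x i = y i" if "i < d" for i
      using digits_unique[of d x "L * D" y i] digL xy that unfolding val_def by auto
    then show "x = y" using xy(1,2) unfolding V_def by (intro PiE_ext) auto
  qed
  have "val ` W \<subseteq> {..<(L * D) ^ d}"
    using digits_less[of d _ "L * D"] digL unfolding W_def val_def by auto
  moreover have "convex_solution_free L (val ` W)"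
    unfolding convex_solution_free_def
  proof (intro allI ballI impI)
    fix p q a b c
    assume pq: "0 < p" "0 < q" "p + q \<le> L"
      and abc: "a \<in> val ` W" "b \<in> val ` W" "c \<in> val ` W" and eq: "p * a + q * b = (p + q) * c"
    obtain x y z where xyz: "x \<in> W" "y \<in> W" "z \<in> W" "a = val x" "b = val y" "c = val z"
      using abc by auto
    then have inV: "x \<in> V" "y \<in> V" "z \<in> V" unfolding W_def by auto
    have small: "(p + q) * w < L * D" if "w < D" for w
    proof -
      have "(p + q) * w \<le> L * w" using pq by simp
      also have "\<dots> < L * D" using \<open>w < D\<close> assms(1) by simp
      finally show ?thesis .
    qed
    have comb: "p * x i + q * y i = (p + q) * z i" if "i < d" for i
    proof (rule digits_unique[of d "\<lambda>j. p * x j + q * y j" "L * D" "\<lambda>j. (p + q) * z j"])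
      show "p * x j + q * y j < L * D" if "j < d" for j
      proof -
        have "p * x j + q * y j \<le> (p + q) * max (x j) (y j)"
          by (simp add: add_mult_distrib add_mono)
        also have "\<dots> < L * D" using small dig inV that by auto
        finally show ?thesis .
      qed
      show "(p + q) * z j < L * D" if "j < d" for j using small dig inV that by auto
      show "(\<Sum>i<d. (p * x i + q * y i) * (L * D) ^ i) = (\<Sum>i<d. (p + q) * z i * (L * D) ^ i)"
        using eq unfolding xyz val_def by (simp add: sum_distrib_left algebra_simps sum.distrib)
    qed fact
    have "x i = y i" if "i < d" for i
      using convex_combination_on_sphere[of p q d x y z R, OF pq(1,2) comb] xyz that
      unfolding W_def N_def by auto
    then have "x = y" using inV unfolding V_def by (intro PiE_ext) auto
    then show "a = b" using xyz by simp
  qed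
  moreover have "D ^ d \<le> card (val ` W) * (d * D\<^sup>2)"
  proof -
    have "card (val ` W) = card W"
      using inj by (intro card_image inj_on_subset[OF inj]) (auto simp: W_def)
    then show ?thesis using R cardV unfolding W_def by (simp add: mult.commute)
  qed
  ultimately show ?thesis by blast
qed

text \<open>
  With \<open>d \<approx> \<surd>log M\<close> digits, both losses in the sphere construction, \<open>L\<^sup>d\<close> from the enlarged base and
  \<open>d D\<^sup>2\<close> from the choice of the radius, are of the form \<open>e\<^bsup>O(\<surd>log M)\<^esup>\<close>.
\<close>

lemma dense_convex_solution_free_set:
  fixes L :: nat
  assumes "0 < L"
  shows "\<exists>b>0. \<exists>M0::nat. \<forall>M\<ge>M0. \<exists>S\<subseteq>{..<M}. convex_solution_free L S \<and>
           real M * exp (- b * sqrt (ln (real M))) \<le> real (card S)"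
proof -
  define b where "b = 2 * ln (2 * real L) + 4"
  \<comment> \<open>\<open>s0\<close> is chosen such that \<open>s \<ge> s0\<close> makes the digit range \<open>E / L\<close> at least 2, hence \<open>D\<close> at least half of it\<close>
  define s0 where "s0 = max 1 (2 * ln (2 * real L))"
  define M0 where "M0 = nat \<lceil>exp (s0\<^sup>2)\<rceil>"
  have lnL: "0 \<le> ln (2 * real L)" using assms by (intro ln_ge_zero) auto
  have "\<exists>S\<subseteq>{..<M}. convex_solution_free L S \<and>
           real M * exp (- b * sqrt (ln (real M))) \<le> real (card S)" if "M \<ge> M0" for M
  proof -
    define l where "l = ln (real M)"
    define s where "s = sqrt l"
    define d where "d = nat \<lceil>s\<rceil>"
    define E where "E = exp (l / real d)"
    define D where "D = nat \<lfloor>E / real L\<rfloor>"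
    have Mge: "exp (s0\<^sup>2) \<le> real M"
      using that unfolding M0_def by (meson nat_ceiling_le_eq)
    then have Mpos: "0 < real M" using exp_gt_zero order_less_le_trans by blast
    have "s0\<^sup>2 \<le> l" unfolding l_def using Mge Mpos by (simp add: ln_ge_iff)
    then have s: "s0 \<le> s" unfolding s_def by (simp add: real_le_rsqrt)
    then have s1: "1 \<le> s" and s2: "2 * ln (2 * real L) \<le> s" unfolding s0_def by auto
    have ll: "l = s\<^sup>2" using s1 unfolding s_def by simp
    have d: "s \<le> real d" "real d \<le> 2 * s" "0 < d" using s1 unfolding d_def by linarith+
    have up: "l / real d \<le> s"
      using d s1 unfolding ll by (simp add: divide_le_eq power2_eq_square)
    have low: "s / 2 \<le> l / real d"
    proof -
      have "s * real d \<le> s * (2 * s)" using d s1 by (intro mult_left_mono) auto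
      then show ?thesis using d unfolding ll by (simp add: field_simps power2_eq_square)
    qed
    have EL: "2 * real L \<le> E"
    proof -
      have "ln (2 * real L) \<le> l / real d" using s2 low by argo
      then have "exp (ln (2 * real L)) \<le> E" unfolding E_def by simp
      then show ?thesis using assms by simp
    qed
    then have "2 \<le> E / real L" using assms by (simp add: le_divide_eq)
    moreover have "real (nat \<lfloor>z\<rfloor>) \<le> z \<and> z / 2 \<le> real (nat \<lfloor>z\<rfloor>) \<and> 0 < nat \<lfloor>z\<rfloor>" if z: "2 \<le> z" for z :: real
    proof -
      have "real (nat \<lfloor>z\<rfloor>) = of_int \<lfloor>z\<rfloor>" using z by simp
      moreover have "of_int \<lfloor>z\<rfloor> \<le> z" "z < of_int \<lfloor>z\<rfloor> + 1" by linarith+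
      moreover have "2 \<le> \<lfloor>z\<rfloor>" using z by (simp add: le_floor_iff)
      then have "2 \<le> real_of_int \<lfloor>z\<rfloor>" by linarith
      ultimately show ?thesis using z by linarith
    qed
    ultimately have D: "real D \<le> E / real L" "E / real L / 2 \<le> real D" "0 < D"
      unfolding D_def by blast+
    have LD: "real L * real D \<le> E" using D(1) assms by (simp add: le_divide_eq mult.commute)
    have E_d: "E ^ d = real M"
    proof -
      have "E ^ d = exp (real d * (l / real d))" unfolding E_def by (rule exp_of_nat_mult[symmetric])
      then show ?thesis using d Mpos by (simp add: l_def)
    qed
    have "real ((L * D) ^ d) \<le> E ^ d"
      using LD by (simp add: power_mono)
    then have LDM: "(L * D) ^ d \<le> M" unfolding E_d by linarith
    obtain S where S: "S \<subseteq> {..<(L * D) ^ d}" "convex_solution_free L S"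
        "D ^ d \<le> card S * (d * D\<^sup>2)"
      using sphere_set[of L D d] assms D d by blast
    have "real M / (2 * real L) ^ d = (E / real L / 2) ^ d"
      by (simp only: E_d[symmetric] power_divide[symmetric]) (simp add: mult.commute)
    also have "\<dots> \<le> real D ^ d"
      using D(2) EL assms by (intro power_mono) auto
    also have "\<dots> \<le> real (card S) * (real d * (real D)\<^sup>2)"
      using S(3) by (metis of_nat_le_iff of_nat_mult of_nat_power)
    also have "\<dots> \<le> real (card S) * (exp (2 * s) * exp (2 * s))"
    proof (intro mult_left_mono mult_mono)
      show "real d \<le> exp (2 * s)"
        using d exp_ge_add_one_self[of "2 * s"] by linarith
      have "real D \<le> real L * real D" using assms D(3) by simp
      then have "real D \<le> exp s" using LD up unfolding E_def
        by (meson exp_le_cancel_iff order_trans)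
      then show "(real D)\<^sup>2 \<le> exp (2 * s)"
        using power_mono[of "real D" "exp s" 2] by (simp add: exp_double)
    qed auto
    finally have main: "real M / (2 * real L) ^ d \<le> real (card S) * (exp (2 * s) * exp (2 * s))" .
    have "(2 * real L) ^ d = exp (real d * ln (2 * real L))"
      using assms by (simp add: exp_of_nat_mult)
    also have "\<dots> \<le> exp (2 * s * ln (2 * real L))"
      using d lnL by (simp add: mult_right_mono)
    finally have pw: "(2 * real L) ^ d \<le> exp (2 * s * ln (2 * real L))" .
    have "real M \<le> real (card S) * (exp (2 * s) * exp (2 * s)) * (2 * real L) ^ d"
      using main assms by (simp add: divide_le_eq)
    also have "\<dots> \<le> real (card S) * (exp (2 * s) * exp (2 * s)) * exp (2 * s * ln (2 * real L))"
      using pw by (intro mult_left_mono) auto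
    also have "\<dots> = real (card S) * exp (b * s)"
      unfolding b_def by (simp add: exp_add[symmetric] algebra_simps)
    finally have "real M * exp (- b * s) \<le> real (card S)"
      by (simp add: exp_minus field_simps)
    then show ?thesis using S LDM unfolding s_def l_def by (intro exI[of _ S]) auto
  qed
  moreover have "0 < b" unfolding b_def using lnL by simp
  ultimately show ?thesis by blast
qed

section \<open>Avoiding affine hexagons\<close>

text \<open>
  The deletion method, derandomised by counting. In an average colouring of \<open>S\<close> with \<open>q\<close> colours a set
  \<open>h\<close> of \<open>k + 1\<close> elements is monochromatic with probability \<open>q\<^bsup>-k\<^esup>\<close>, so some colouring has at most
  \<open>|H| / q\<^sup>k\<close> monochromatic members of \<open>H\<close>. Remove one element from each of these and take the largest
  of the remaining colour classes.
\<close>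

lemma independent_subset_by_colouring:
  fixes S :: "'a set" and H :: "'a set set"
  assumes "finite S" and "0 < q" and H: "\<And>h. h \<in> H \<Longrightarrow> h \<subseteq> S \<and> card h = Suc k"
  shows "\<exists>T\<subseteq>S. (\<forall>h\<in>H. \<not> h \<subseteq> T) \<and> card S * q ^ k \<le> card H + q ^ Suc k * card T"
proof -
  have finH: "finite H"
    using H assms(1) by (intro finite_subset[of H "Pow S"]) auto
  have finh: "finite h" if "h \<in> H" for h using H[OF that] by (metis card.infinite nat.distinct(1))
  define Col where "Col = S \<rightarrow>\<^sub>E {..<q}"
  define mono where "mono = (\<lambda>f :: 'a \<Rightarrow> nat. {h\<in>H. \<exists>c<q. \<forall>x\<in>h. f x = c})"
  have finC: "finite Col" unfolding Col_def using assms(1) by (intro finite_PiE) auto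
  have cardC: "card Col = q ^ card S" unfolding Col_def using assms(1) by (subst card_PiE) auto
  have one: "card {f\<in>Col. h \<in> mono f} * q ^ k \<le> q ^ card S" if h: "h \<in> H" for h
  proof -
    have hS: "h \<subseteq> S" "card h = Suc k" using H[OF h] by auto
    have fh: "finite h" using finh[OF h] .
    have "card (PiE S (\<lambda>x. if x \<in> h then {c} else {..<q})) = q ^ (card S - Suc k)" if "c < q" for c
    proof -
      have "card (PiE S (\<lambda>x. if x \<in> h then {c} else {..<q})) = (\<Prod>x\<in>S. if x \<in> h then 1 else q)"
        using assms(1) by (subst card_PiE) (auto intro!: prod.cong)
      also have "\<dots> = (\<Prod>x\<in>S - h. q)"
        using assms(1) by (intro prod.mono_neutral_cong_right) auto
      also have "\<dots> = q ^ (card S - Suc k)"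
        using hS fh by (simp add: card_Diff_subset)
      finally show ?thesis .
    qed
    note fibre = this
    have "{f\<in>Col. h \<in> mono f} \<subseteq> (\<Union>c<q. PiE S (\<lambda>x. if x \<in> h then {c} else {..<q}))"
      unfolding Col_def mono_def PiE_def Pi_def by auto
    then have "card {f\<in>Col. h \<in> mono f} \<le> card (\<Union>c<q. PiE S (\<lambda>x. if x \<in> h then {c} else {..<q}))"
      using assms(1) by (intro card_mono) (auto intro!: finite_PiE)
    also have "\<dots> \<le> (\<Sum>c<q. card (PiE S (\<lambda>x. if x \<in> h then {c} else {..<q})))"
      by (rule card_UN_le) simp
    also have "\<dots> = q * q ^ (card S - Suc k)" using fibre by simp
    finally have "card {f\<in>Col. h \<in> mono f} * q ^ k \<le> q * q ^ (card S - Suc k) * q ^ k"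
      by (rule mult_right_mono) simp
    also have "\<dots> = q ^ (Suc k + (card S - Suc k))" by (simp add: power_add mult_ac)
    also have "Suc k + (card S - Suc k) = card S"
      using card_mono[OF assms(1) hS(1)] hS(2) by simp
    finally show ?thesis .
  qed
  have "\<exists>f\<in>Col. card (mono f) * q ^ k \<le> card H"
  proof (rule ccontr)
    assume "\<not> ?thesis"
    then have big: "card H < card (mono f) * q ^ k" if "f \<in> Col" for f using that by auto
    have "Col \<noteq> {}" using cardC assms(2) by auto
    then have "card Col * card H < (\<Sum>f\<in>Col. card (mono f) * q ^ k)"
      using sum_strict_mono[OF finC, of "\<lambda>_. card H"] big by simp
    also have "\<dots> = (\<Sum>f\<in>Col. \<Sum>h\<in>H. if h \<in> mono f then q ^ k else 0)"
    proof (rule sum.cong)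
      fix f
      have "(\<Sum>h\<in>H. if h \<in> mono f then q ^ k else 0) = (\<Sum>h\<in>{h\<in>H. h \<in> mono f}. q ^ k)"
        by (rule sum.inter_filter[OF finH, symmetric])
      also have "{h\<in>H. h \<in> mono f} = mono f" unfolding mono_def by auto
      finally show "card (mono f) * q ^ k = (\<Sum>h\<in>H. if h \<in> mono f then q ^ k else 0)" by simp
    qed simp
    also have "\<dots> = (\<Sum>h\<in>H. \<Sum>f\<in>Col. if h \<in> mono f then q ^ k else 0)"
      by (rule sum.swap)
    also have "\<dots> = (\<Sum>h\<in>H. card {f\<in>Col. h \<in> mono f} * q ^ k)"
      using finC by (simp flip: sum.inter_filter)
    also have "\<dots> \<le> (\<Sum>h\<in>H. q ^ card S)" using one by (intro sum_mono) auto
    also have "\<dots> = card Col * card H" using cardC by simp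
    finally show False by simp
  qed
  then obtain f where f: "f \<in> Col" "card (mono f) * q ^ k \<le> card H" by blast
  have f_less: "f x < q" if "x \<in> S" for x using f(1) that unfolding Col_def by auto
  \<comment> \<open>one element is deleted from every monochromatic member of \<open>H\<close>\<close>
  define D where "D = (\<lambda>h. SOME x. x \<in> h) ` mono f"
  have finM: "finite (mono f)" using finH unfolding mono_def by auto
  have cardD: "card D \<le> card (mono f)" unfolding D_def using finM by (rule card_image_le)
  have "\<exists>c<q. card (S - D) \<le> q * card {x\<in>S - D. f x = c}"
    by (rule pigeonhole_fibre) (use assms f_less in auto)
  then obtain c where c: "c < q" "card (S - D) \<le> q * card {x\<in>S - D. f x = c}" by blast
  define T where "T = {x\<in>S - D. f x = c}"
  have "\<not> h \<subseteq> T" if h: "h \<in> H" for h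
  proof
    assume hT: "h \<subseteq> T"
    then have "h \<in> mono f" using h c(1) unfolding mono_def T_def by auto
    then have "(SOME x. x \<in> h) \<in> D" unfolding D_def by auto
    moreover have "h \<noteq> {}" using H[OF h] by auto
    then have "(SOME x. x \<in> h) \<in> h" by (simp add: some_in_eq)
    ultimately show False using hT unfolding T_def by auto
  qed
  moreover have "card S * q ^ k \<le> card H + q ^ Suc k * card T"
  proof -
    have "card S \<le> card (S - D) + card D"
      using card_mono[of "(S - D) \<union> D" S] card_Un_le[of "S - D" D] assms(1) finM unfolding D_def by fastforce
    then have "card S \<le> q * card T + card (mono f)" using c(2) cardD unfolding T_def by linarith
    then have "card S * q ^ k \<le> (q * card T + card (mono f)) * q ^ k" by (rule mult_right_mono) simp
    also have "\<dots> \<le> card H + q ^ Suc k * card T" using f(2) by (simp add: algebra_simps)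
    finally show ?thesis .
  qed
  moreover have "T \<subseteq> S" unfolding T_def by auto
  ultimately show ?thesis by blast
qed

text \<open>
  The six velocities of a hexagonal configuration of particles with times \<open>0, 1, 2\<close>: the projections of
  the vertices of a hexagon whose opposite sides and one main diagonal are parallel, for each of three directions. The
  sides have alternating lengths proportional to \<open>s\<close> and \<open>t\<close>.
\<close>

definition hexagon :: "nat \<Rightarrow> nat \<Rightarrow> nat \<Rightarrow> nat set" where
  "hexagon a s t = {a, a + s, a + t, a + s + 2 * t, a + 2 * s + t, a + 2 * s + 2 * t}"

text \<open>
  For \<open>s = t\<close> two pairs of the six numbers coincide. These degenerate patterns are left out here, so that all patterns have six
  elements and can be deleted by the same count; in the degenerate ones, one element is a weighted average of two
  others, and a set without weighted averages avoids them.
\<close>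

definition hexagon_free :: "nat set \<Rightarrow> bool" where
  "hexagon_free T \<longleftrightarrow> (\<forall>a s t. 0 < s \<longrightarrow> 0 < t \<longrightarrow> s \<noteq> t \<longrightarrow> \<not> hexagon a s t \<subseteq> T)"

lemma hexagon_free_subset:
  assumes "S \<subseteq> {..<M}" and "0 < q"
  shows "\<exists>T\<subseteq>S. hexagon_free T \<and> card S * q ^ 5 \<le> M ^ 3 + q ^ 6 * card T"
proof -
  define I where "I = {(a, s, t). 0 < s \<and> 0 < t \<and> s \<noteq> t \<and> hexagon a s t \<subseteq> S}"
  define H where "H = (\<lambda>(a, s, t). hexagon a s t) ` I"
  have sub: "I \<subseteq> {..<M} \<times> {..<M} \<times> {..<M}"
    using assms(1) unfolding I_def hexagon_def by fastforce
  have "card H \<le> card I"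
    unfolding H_def by (intro card_image_le finite_subset[OF sub]) auto
  also have "\<dots> \<le> card ({..<M} \<times> {..<M} \<times> {..<M})"
    by (rule card_mono[OF _ sub]) auto
  also have "\<dots> = M ^ 3" by (simp add: card_cartesian_product power3_eq_cube)
  finally have cardH: "card H \<le> M ^ 3" .
  have "h \<subseteq> S \<and> card h = Suc 5" if h_in: "h \<in> H" for h
  proof -
    obtain a s t where h: "h = hexagon a s t" "0 < s" "0 < t" "s \<noteq> t" "h \<subseteq> S"
      using h_in unfolding H_def I_def by auto
    have "distinct [a, a + s, a + t, a + s + 2 * t, a + 2 * s + t, a + 2 * s + 2 * t]"
      using h(2-4) by auto
    from distinct_card[OF this] show ?thesis using h(1,5) unfolding hexagon_def by simp
  qed
  then obtain T where T: "T \<subseteq> S" "\<forall>h\<in>H. \<not> h \<subseteq> T" "card S * q ^ 5 \<le> card H + q ^ Suc 5 * card T"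
    using independent_subset_by_colouring[of S q H 5] assms finite_subset[OF assms(1)] by blast
  have "hexagon_free T"
    unfolding hexagon_free_def using T(1,2) unfolding H_def I_def by fastforce
  then show ?thesis using T cardH by (intro exI[of _ T]) auto
qed

text \<open>
  A Behrend set of size \<open>N\<close> is thinned out with \<open>q \<approx> (M\<^sup>3 / N)\<^bsup>1/5\<^esup>\<close> colours. This is the threshold at which at
  most half of \<open>N\<close> is lost to the at most \<open>M\<^sup>3\<close> hexagons, and \<open>N / q\<close> is then about \<open>M\<^bsup>3/5\<^esup>\<close>.
\<close>

lemma dense_hexagon_free_set:
  fixes L :: nat
  assumes "0 < L"
  shows "\<exists>b>0. \<exists>M0::nat. \<forall>M\<ge>M0. \<exists>S\<subseteq>{..<M}. convex_solution_free L S \<and> hexagon_free S \<and>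
           real M powr (3/5) * exp (- b * sqrt (ln (real M))) / 8 \<le> real (card S)"
proof -
  obtain b M0 where b: "b > 0" and beh: "\<And>M. M \<ge> M0 \<Longrightarrow> \<exists>S\<subseteq>{..<M}. convex_solution_free L S \<and>
           real M * exp (- b * sqrt (ln (real M))) \<le> real (card S)"
    using dense_convex_solution_free_set[OF assms] by blast
  have "\<exists>T\<subseteq>{..<M}. convex_solution_free L T \<and> hexagon_free T \<and>
     real M powr (3/5) * exp (- (6 / 5 * b) * sqrt (ln (real M))) / 8 \<le> real (card T)" if M: "M \<ge> max M0 1" for M
  proof -
    obtain S where S: "S \<subseteq> {..<M}" "convex_solution_free L S"
        "real M * exp (- b * sqrt (ln (real M))) \<le> real (card S)"
      using beh[of M] M by auto
    define m where "m = real M"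
    define e where "e = exp (b * sqrt (ln m))"
    define N where "N = real (card S)"
    have m1: "1 \<le> m" using M unfolding m_def by simp
    have e1: "1 \<le> e" unfolding e_def using b m1 by simp
    have NN: "m \<le> N * e"
      using S(3) unfolding N_def e_def m_def by (simp add: exp_minus field_simps)
    define z where "z = (2 * m\<^sup>2 * e) powr (1/5)"
    have arg: "1 \<le> 2 * m\<^sup>2 * e"
    proof -
      have "1 \<le> m\<^sup>2" using m1 by (rule one_le_power)
      then show ?thesis using e1 mult_mono[of 1 "2 * m\<^sup>2" 1 e] by simp
    qed
    have z1: "1 \<le> z" unfolding z_def using arg by (simp add: ge_one_powr_ge_zero)
    have z5: "z ^ 5 = 2 * m\<^sup>2 * e"
    proof -
      have "z ^ 5 = z powr real 5" using z1 by (intro powr_realpow[symmetric]) auto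
      also have "\<dots> = 2 * m\<^sup>2 * e" unfolding z_def powr_powr using arg by simp
      finally show ?thesis .
    qed
    define q where "q = nat \<lceil>z\<rceil>"
    have q: "z \<le> real q" "real q \<le> 2 * z" "0 < q" using z1 unfolding q_def by linarith+
    obtain T where T: "T \<subseteq> S" "hexagon_free T" "card S * q ^ 5 \<le> M ^ 3 + q ^ 6 * card T"
      using hexagon_free_subset[OF S(1) q(3)] by blast
    have T3: "N * real q ^ 5 \<le> m ^ 3 + real q ^ 6 * real (card T)"
      using T(3) unfolding N_def m_def by (metis of_nat_add of_nat_le_iff of_nat_mult of_nat_power)
    have N0: "0 \<le> N" unfolding N_def by simp
    have "2 * m ^ 3 \<le> 2 * m\<^sup>2 * (N * e)"
      using mult_left_mono[OF NN, of "2 * m\<^sup>2"] by (simp add: power3_eq_cube power2_eq_square mult_ac)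
    also have "\<dots> = N * z ^ 5" unfolding z5 by simp
    also have "\<dots> \<le> N * real q ^ 5" using q z1 N0 by (intro mult_left_mono power_mono) auto
    finally have "N * real q ^ 5 \<le> 2 * (real q ^ 6 * real (card T))" using T3 by linarith
    also have "\<dots> = (2 * real q * real (card T)) * real q ^ 5" using power_Suc[of "real q" 5] by simp
    finally have "N \<le> 2 * real q * real (card T)" using q(3) by simp
    also have "\<dots> \<le> 4 * z * real (card T)" using q(2) by (simp add: mult_right_mono)
    finally have NT: "N \<le> 4 * z * real (card T)" .
    have zle: "z \<le> 2 * (m powr (2/5) * e powr (1/5))"
    proof -
      have "m\<^sup>2 = m powr 2" using m1 by (simp add: powr_numeral)
      then have "m\<^sup>2 powr (1/5) = m powr (2/5)" by (simp only: powr_powr) simp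
      then have "z = 2 powr (1/5) * (m powr (2/5) * e powr (1/5))"
        unfolding z_def using m1 e1 by (simp add: powr_mult mult.assoc)
      moreover have "(2::real) powr (1/5) \<le> 2" using powr_mono[of "1/5" 1 "2::real"] by simp
      ultimately show ?thesis using mult_right_mono[of "2 powr (1/5)" 2 "m powr (2/5) * e powr (1/5)"] by auto
    qed
    have "m \<le> 4 * z * real (card T) * e"
      using NN mult_right_mono[OF NT, of e] e1 by linarith
    also have "\<dots> \<le> 4 * (2 * (m powr (2/5) * e powr (1/5))) * real (card T) * e"
      using zle e1 by (intro mult_right_mono mult_left_mono) auto
    also have "\<dots> = 8 * real (card T) * (e powr (6/5)) * m powr (2/5)"
    proof -
      have "e powr (6/5) = e powr (1/5) * e" using e1 powr_add[of e "1/5" 1] by simp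
      then show ?thesis by simp
    qed
    finally have "m \<le> 8 * real (card T) * (e powr (6/5)) * m powr (2/5)" .
    moreover have "m = m powr (3/5) * m powr (2/5)" using m1 powr_add[of m "3/5" "2/5"] by simp
    ultimately have "m powr (3/5) \<le> 8 * real (card T) * (e powr (6/5))"
      using m1 by (metis mult_le_cancel_right_pos powr_gt_zero less_le_trans zero_less_one less_irrefl)
    moreover have "e powr (6/5) = exp (6 / 5 * b * sqrt (ln m))"
      unfolding e_def by (simp add: powr_def)
    ultimately have "m powr (3/5) * exp (- (6 / 5 * b) * sqrt (ln m)) / 8 \<le> real (card T)"
      by (simp add: exp_minus field_simps)
    moreover have "convex_solution_free L T"
      using S(2) T(1) unfolding convex_solution_free_def by blast
    ultimately show ?thesis using T S(1) unfolding m_def by (intro exI[of _ T]) auto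
  qed
  moreover have "0 < 6 / 5 * b" using b by simp
  ultimately show ?thesis by blast
qed

section \<open>Particles that are paired in every snapshot\<close>

text \<open>
  Here \<open>f k\<close> gives the positions at the \<open>k\<close>-th of five consecutive snapshots, in each of which the two
  classes \<open>A\<close> and \<open>B\<close> occupy the same places, and particles of different classes never pass each other strictly between
  two snapshots. The lowest pair changes by one particle from each snapshot to the next, because the slower of its two
  members remains in it: a particle of the other class could get below it only by passing it between snapshots. This gives the
  chain \<open>p 0, \<dots>, p 5\<close>, in which neighbours meet. Now let \<open>p i\<close> and \<open>p j\<close> be of different classes. The one with smaller
  index is lower early and higher late, so they meet, and since passing is possible only in a snapshot where they are together,
  it remains to exclude all snapshots but the middle one, in which one of them is already paired with another
  member of the chain.
\<close>

lemma alternating_chain: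
  fixes f :: "nat \<Rightarrow> 'a \<Rightarrow> int" and A B :: "'a set"
  assumes fin: "finite A" and ne: "A \<noteq> {}"
    and inj: "\<And>k. k < 5 \<Longrightarrow> inj_on (f k) A" "\<And>k. k < 5 \<Longrightarrow> inj_on (f k) B"
    and same: "\<And>k. k < 5 \<Longrightarrow> f k ` A = f k ` B"
    and separate: "\<And>k l X Y. k < l \<Longrightarrow> l < k + 3 \<Longrightarrow> l < 5 \<Longrightarrow> X \<in> A \<Longrightarrow> Y \<in> B \<Longrightarrow>
                     f k X = f k Y \<Longrightarrow> f l X \<noteq> f l Y"
    and no_crossing:
      "\<And>k X Y. k < 4 \<Longrightarrow> X \<in> A \<Longrightarrow> Y \<in> B \<Longrightarrow> f k X < f k Y \<Longrightarrow> f (Suc k) X \<le> f (Suc k) Y"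
      "\<And>k X Y. k < 4 \<Longrightarrow> X \<in> A \<Longrightarrow> Y \<in> B \<Longrightarrow> f k Y < f k X \<Longrightarrow> f (Suc k) Y \<le> f (Suc k) X"
    and swap: "\<And>k X Y. k < 3 \<Longrightarrow> f k X < f k Y \<Longrightarrow> f (Suc k) X = f (Suc k) Y \<Longrightarrow>
                 f (Suc (Suc k)) Y < f (Suc (Suc k)) X"
  shows "\<exists>p :: nat \<Rightarrow> 'a.
     ((p 0 \<in> A \<and> p 1 \<in> B \<and> p 2 \<in> A \<and> p 3 \<in> B \<and> p 4 \<in> A \<and> p 5 \<in> B) \<or>
      (p 0 \<in> B \<and> p 1 \<in> A \<and> p 2 \<in> B \<and> p 3 \<in> A \<and> p 4 \<in> B \<and> p 5 \<in> A)) \<and>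
     f 0 (p 0) = f 0 (p 1) \<and> f 1 (p 1) = f 1 (p 2) \<and> f 2 (p 2) = f 2 (p 3) \<and>
     f 3 (p 3) = f 3 (p 4) \<and> f 4 (p 4) = f 4 (p 5) \<and>
     f 1 (p 0) = f 1 (p 3) \<and> f 2 (p 1) = f 2 (p 4) \<and> f 3 (p 2) = f 3 (p 5) \<and>
     f 2 (p 0) = f 2 (p 5) \<and>
     f 1 (p 1) < f 1 (p 0) \<and> f 4 (p 4) < f 4 (p 3)"
proof -
  define opp where "opp X Y \<longleftrightarrow> (X \<in> A \<and> Y \<in> B) \<or> (X \<in> B \<and> Y \<in> A)" for X Y
  define bottom where
    "bottom k X Y \<longleftrightarrow> opp X Y \<and> f k X = f k Y \<and> (\<forall>W\<in>A \<union> B. f k X \<le> f k W)" for k X Y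
  have sym: "opp X Y \<Longrightarrow> opp Y X" for X Y unfolding opp_def by auto
  have keep: "f (Suc k) X \<le> f (Suc k) Y" if "k < 4" "opp X Y" "f k X < f k Y" for k X Y
    using no_crossing that unfolding opp_def by blast
  have inj_opp: "X = Y" if "k < 5" "opp X Z" "opp Y Z" "f k X = f k Y" "A \<inter> B = {}" for k X Y Z
    using inj[OF that(1)] that unfolding opp_def inj_on_def by blast
  have disj: "A \<inter> B = {}" using separate[of 0 1] by fastforce
  have partner: "\<exists>Y. opp X Y \<and> f k Y = f k X" if "k < 5" "X \<in> A \<union> B" for k X
    using same[OF that(1)] that(2) unfolding opp_def by (auto simp: image_def set_eq_iff) metis+
  have opp3: "opp X Z \<or> opp X W" if "opp Z W" "X \<in> A \<union> B" for X Z W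
    using that unfolding opp_def by blast

  \<comment> \<open>the lowest pair of the first snapshot, ordered such that the second member is the slower one\<close>
  have start: "\<exists>X Y. bottom 0 X Y \<and> f 1 Y < f 1 X"
  proof -
    obtain X where X: "X \<in> A" "\<And>W. W \<in> A \<Longrightarrow> f 0 X \<le> f 0 W"
      using ex_min_if_finite[of "f 0 ` A"] fin ne by (metis (no_types, lifting) finite_imageI image_is_empty imageE imageI linorder_not_le)
    obtain Y where Y: "opp X Y" "f 0 Y = f 0 X" using partner[of 0 X] X by auto
    have min: "f 0 X \<le> f 0 W" if "W \<in> A \<union> B" for W
    proof -
      have "f 0 W \<in> f 0 ` A" using that same[of 0] by auto
      then show ?thesis using X(2) by auto
    qed
    have "Y \<in> B" using Y(1) X(1) disj unfolding opp_def by blast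
    then have "f 1 X \<noteq> f 1 Y" using separate[of 0 1 X Y] X(1) Y(2) by auto
    moreover have "bottom 0 X Y" "bottom 0 Y X" using X Y min sym unfolding bottom_def by auto
    ultimately show ?thesis by (metis linorder_neqE)
  qed
  \<comment> \<open>the slower member \<open>Y\<close> of the lowest pair is in the next lowest pair, where it is the faster member\<close>
  have step: "\<exists>Z. bottom (Suc k) Y Z \<and> f k Y < f k Z"
    if k: "k < 4" and bot: "bottom k X Y" and slow: "f (Suc k) Y < f (Suc k) X" for k X Y
  proof -
    have XY: "opp X Y" "f k X = f k Y" "\<And>W. W \<in> A \<union> B \<Longrightarrow> f k Y \<le> f k W"
      using bot unfolding bottom_def by auto
    have Y: "Y \<in> A \<union> B" using XY(1) unfolding opp_def by auto
    have above: "f k Y < f k W" if "opp Y W" "W \<noteq> X" for W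
    proof -
      have "f k Y \<noteq> f k W" using inj_opp[of k W Y X] that XY sym k disj by auto
      moreover have "f k Y \<le> f k W" using XY(3) that(1) unfolding opp_def by auto
      ultimately show ?thesis by simp
    qed
    have opp_above: "f (Suc k) Y \<le> f (Suc k) W" if "opp Y W" for W
      using above[OF that] keep[OF k that] slow by fastforce
    obtain Z where Z: "opp Y Z" "f (Suc k) Z = f (Suc k) Y" using partner[of "Suc k" Y] Y k by auto
    have "f (Suc k) Y \<le> f (Suc k) W" if W: "W \<in> A \<union> B" for W
    proof -
      obtain W' where W': "opp W W'" "f (Suc k) W' = f (Suc k) W"
        using partner[of "Suc k" W] W k by auto
      then show ?thesis using opp3[OF W'(1) Y] opp_above by metis
    qed
    moreover have "Z \<noteq> X" using Z slow by auto
    ultimately show ?thesis using Z above unfolding bottom_def by auto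
  qed
  obtain p0 p1 where b0: "bottom 0 p0 p1" and s0: "f 1 p1 < f 1 p0" using start by blast
  obtain p2 where b1: "bottom 1 p1 p2" and l1: "f 0 p1 < f 0 p2" using step[of 0, OF _ b0] s0 by auto
  have s1: "f 2 p2 < f 2 p1" using swap[of 0 p1 p2] b1 l1 unfolding bottom_def by (simp add: numeral_2_eq_2)
  obtain p3 where b2: "bottom 2 p2 p3" and l2: "f 1 p2 < f 1 p3" using step[of 1, OF _ b1] s1 by (auto simp: numeral_2_eq_2)
  have s2: "f 3 p3 < f 3 p2" using swap[of 1 p2 p3] b2 l2 unfolding bottom_def by (simp add: numeral_2_eq_2 numeral_3_eq_3)
  obtain p4 where b3: "bottom 3 p3 p4" and l3: "f 2 p3 < f 2 p4" using step[of 2, OF _ b2] s2 by (auto simp: numeral_2_eq_2 numeral_3_eq_3)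
  have s3: "f 4 p4 < f 4 p3" using swap[of 2 p3 p4] b3 l3 unfolding bottom_def by (simp add: eval_nat_numeral)
  obtain p5 where b4: "bottom 4 p4 p5" and l4: "f 3 p4 < f 3 p5" using step[of 3, OF _ b3] s3 by (auto simp: eval_nat_numeral)
  have colours: "(p0 \<in> A \<and> p1 \<in> B \<and> p2 \<in> A \<and> p3 \<in> B \<and> p4 \<in> A \<and> p5 \<in> B) \<or>
      (p0 \<in> B \<and> p1 \<in> A \<and> p2 \<in> B \<and> p3 \<in> A \<and> p4 \<in> B \<and> p5 \<in> A)"
    using b0 b1 b2 b3 b4 disj unfolding bottom_def opp_def by blast
  have opps: "opp p0 p3" "opp p1 p4" "opp p2 p5" "opp p0 p5"
    using colours unfolding opp_def by auto
  have below: "f k X < f k W" if "k < 5" "bottom k X Y" "opp X W" "W \<noteq> Y" for k X Y W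
  proof -
    have "f k X \<noteq> f k W" using inj_opp[of k Y X W] that sym disj unfolding bottom_def by metis
    moreover have "f k X \<le> f k W" using that unfolding bottom_def opp_def by auto
    ultimately show ?thesis by simp
  qed
  have flip: "bottom k Y X" if "bottom k X Y" for k X Y
    using that sym unfolding bottom_def by auto
  have eqs: "f 0 p0 = f 0 p1" "f 1 p1 = f 1 p2" "f 2 p2 = f 2 p3" "f 3 p3 = f 3 p4" "f 4 p4 = f 4 p5"
    using b0 b1 b2 b3 b4 unfolding bottom_def by auto
  have ne: "p0 \<noteq> p2" "p1 \<noteq> p3" "p2 \<noteq> p4" "p3 \<noteq> p5"
    using s0 s1 s2 s3 eqs by auto
  \<comment> \<open>a change of order between snapshots \<open>k\<close> and \<open>k + 2\<close> can happen only at snapshot \<open>k + 1\<close>\<close>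
  have meet: "f (Suc k) X = f (Suc k) Y"
    if "k < 3" "opp X Y" "f k X < f k Y" "f (Suc (Suc k)) Y < f (Suc (Suc k)) X" for k X Y
    using keep[of k X Y] keep[of "Suc k" X Y] that by fastforce
  have m03: "f 1 p0 = f 1 p3"
    using meet[of 0 p0 p3, OF _ opps(1)] below[OF _ b0 opps(1)] below[OF _ flip[OF b2] sym[OF opps(1)]] ne
    by (auto simp: numeral_2_eq_2)
  have m14: "f 2 p1 = f 2 p4"
    using meet[of 1 p1 p4, OF _ opps(2)] below[OF _ b1 opps(2)] below[OF _ flip[OF b3] sym[OF opps(2)]] ne
    by (auto simp: eval_nat_numeral)
  have m25: "f 3 p2 = f 3 p5"
    using meet[of 2 p2 p5, OF _ opps(3)] below[OF _ b2 opps(3)] below[OF _ flip[OF b4] sym[OF opps(3)]] ne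
    by (auto simp: eval_nat_numeral)
  \<comment> \<open>for \<open>p0\<close> and \<open>p5\<close> the order at the outer snapshots 0 and 4 must be carried to 1 and 3,\<close>
  \<comment> \<open>where ties are impossible as \<open>p0\<close> is paired with \<open>p3\<close> and \<open>p5\<close> with \<open>p2\<close>\<close>
  have "p1 \<noteq> p5"
    using m25 eqs(2) separate[of 1 3 p1 p2] separate[of 1 3 p2 p1] colours by auto
  moreover have "p0 \<noteq> p4"
    using m03 eqs(4) separate[of 1 3 p4 p3] separate[of 1 3 p3 p4] colours by auto
  ultimately have "f 0 p0 < f 0 p5" "f 4 p5 < f 4 p0"
    using below[OF _ b0 opps(4)] below[OF _ flip[OF b4] sym[OF opps(4)]] by auto
  then have weak: "f 1 p0 \<le> f 1 p5" "\<not> f 3 p0 < f 3 p5"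
    using keep[of 0 p0 p5] keep[of 3 p0 p5] opps(4) by auto
  have "f 1 p3 \<noteq> f 1 p5" "f 3 p0 \<noteq> f 3 p2"
    using inj_opp[of 1 p3 p0 p5] inj_opp[of 3 p0 p5 p2] ne disj opps sym by auto
  then have "f 1 p0 < f 1 p5" "f 3 p5 < f 3 p0" using weak m03 m25 by auto
  then have m05: "f 2 p0 = f 2 p5"
    using meet[of 1 p0 p5] opps(4) by (auto simp: eval_nat_numeral)
  define p where "p = (\<lambda>k. [p0, p1, p2, p3, p4, p5] ! k)"
  have p: "p 0 = p0" "p 1 = p1" "p 2 = p2" "p 3 = p3" "p 4 = p4" "p 5 = p5"
    unfolding p_def by (auto simp: eval_nat_numeral)
  show ?thesis
    by (rule exI[of _ p], unfold p) (use colours eqs m03 m14 m25 m05 s0 s3 in blast)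
qed

section \<open>Integer grids\<close>

text \<open>
  The times \<open>c\<^sub>k\<close> of the snapshots: \<open>0, 1, 2, 3, 5, 6, \<dots>\<close>. The gap at \<open>4\<close> matters: for the five equally spaced
  times \<open>0, \<dots>, 4\<close> the nine meetings provided by \<open>alternating_chain\<close> have nontrivial common solutions.
\<close>

definition snapshot_time :: "nat \<Rightarrow> nat" where
  "snapshot_time k = (if k < 4 then k else Suc k)"

lemma snapshot_time_mono: "k \<le> l \<Longrightarrow> snapshot_time k \<le> snapshot_time l"
  unfolding snapshot_time_def by auto

lemma snapshot_time_inj: "snapshot_time k = snapshot_time l \<longleftrightarrow> k = l"
  unfolding snapshot_time_def by auto

lemma snapshot_time_le: "k < r \<Longrightarrow> snapshot_time k \<le> r"
  unfolding snapshot_time_def by auto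

text \<open>
  The place, at the \<open>k\<close>-th snapshot, of the particle with starting point \<open>fst P\<close> and velocity \<open>snd P\<close>.
\<close>

definition position :: "nat \<Rightarrow> int \<times> int \<Rightarrow> int" where
  "position k P = fst P + int (snapshot_time k) * snd P"

text \<open>
  Continuation of the sequence of snapshots beyond the \<open>r\<close>-th one. The positions are linear forms on the
  plane whose directions turn monotonically, and after half a turn they return to the first form with the opposite sign.
  This makes five consecutive snapshots available also for \<open>r = 3\<close> and \<open>r = 4\<close>.
\<close>

definition cyclic_position :: "nat \<Rightarrow> nat \<Rightarrow> int \<times> int \<Rightarrow> int" where
  "cyclic_position r k P = (if k < r then position k P else - position (k - r) P)"

text \<open>
  The difference of the positions of two particles is an affine function of time. If it vanishes at one of the \<open>r\<close>
  snapshots, it has no zero strictly between two consecutive ones. At the turn from the last snapshot back to the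
  first, the zero lies between these two times, so the difference does not have the same sign at both, and the change of sign of the
  form restores the order.
\<close>

lemma no_crossing_between_consecutive_times:
  assumes r: "2 \<le> r" and m: "m < r" "position m X = position m Y"
    and k: "k < r + r - 1" and lt: "cyclic_position r k X < cyclic_position r k Y"
  shows "cyclic_position r (Suc k) X \<le> cyclic_position r (Suc k) Y"
proof -
  define dx where "dx = fst X - fst Y"
  define da where "da = snd X - snd Y"
  have diff: "position j X - position j Y = dx + int (snapshot_time j) * da" for j
    unfolding position_def dx_def da_def by (simp add: algebra_simps)
  have m0: "dx + int (snapshot_time m) * da = 0" using m(2) diff[of m] by simp
  have up: "int (snapshot_time i) * da \<le> int (snapshot_time j) * da" if "i \<le> j" "0 \<le> da" for i j
    using that snapshot_time_mono[of i j] by (intro mult_right_mono) auto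
  have down: "int (snapshot_time j) * da \<le> int (snapshot_time i) * da" if "i \<le> j" "da \<le> 0" for i j
    using that snapshot_time_mono[of i j] by (intro mult_right_mono_neg) auto
  have inner: "\<not> (dx + int (snapshot_time j) * da < 0 \<and> 0 < dx + int (snapshot_time (Suc j)) * da)"
      "\<not> (0 < dx + int (snapshot_time j) * da \<and> dx + int (snapshot_time (Suc j)) * da < 0)" for j
  proof -
    consider "0 \<le> da" "m \<le> j" | "0 \<le> da" "Suc j \<le> m" | "da \<le> 0" "m \<le> j" | "da \<le> 0" "Suc j \<le> m"
      by linarith
    note cases = this
    show "\<not> (dx + int (snapshot_time j) * da < 0 \<and> 0 < dx + int (snapshot_time (Suc j)) * da)"
      using up[of m j] up[of "Suc j" m] up[of j "Suc j"] down[of m "Suc j"] down[of j "Suc j"] down[of j m] m0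
      by (cases rule: cases) auto
    show "\<not> (0 < dx + int (snapshot_time j) * da \<and> dx + int (snapshot_time (Suc j)) * da < 0)"
      using up[of j "Suc j"] down[of m j] down[of "Suc j" m] m0
      by (cases rule: cases) auto
  qed
  consider "Suc k < r" | "Suc k = r" | "r \<le> k" by linarith
  then show ?thesis
  proof cases
    case 1
    then show ?thesis
      using lt inner(1)[of k] diff[of k] diff[of "Suc k"] unfolding cyclic_position_def by auto
  next
    case 2
    have "\<not> (dx + int (snapshot_time k) * da < 0 \<and> dx + int (snapshot_time 0) * da < 0)"
    proof (cases "0 \<le> da")
      case True
      have "m \<le> k" using 2 m(1) by simp
      from up[OF this True] show ?thesis using m0 by linarith
    next
      case False
      then have "int (snapshot_time m) * da \<le> int (snapshot_time 0) * da" by (intro down) auto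
      then show ?thesis using m0 by linarith
    qed
    then show ?thesis
      using lt 2 r diff[of k] diff[of 0] unfolding cyclic_position_def by auto
  next
    case 3
    then show ?thesis
      using lt inner(2)[of "k - r"] diff[of "k - r"] diff[of "Suc k - r"]
      unfolding cyclic_position_def by (auto simp: Suc_diff_le)
  qed
qed

text \<open>
  For \<open>r = 3\<close> the nine meetings of \<open>alternating_chain\<close> are all the meetings between the two classes; \<open>x\<close> and \<open>a\<close>
  are the starting points and velocities along the chain, and the signs come from the cyclic continuation.
\<close>

lemma hexagon_of_meetings:
  fixes x0 x1 x2 x3 x4 x5 a0 a1 a2 a3 a4 a5 :: int
  assumes "x0 = x1" "x1 + a1 = x2 + a2" "x2 + 2 * a2 = x3 + 2 * a3" "- x3 = - x4"
    "- (x4 + a4) = - (x5 + a5)" "x0 + a0 = x3 + a3" "x1 + 2 * a1 = x4 + 2 * a4" "- x2 = - x5"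
    "x0 + 2 * a0 = x5 + 2 * a5"
  shows "a2 = a3 + (a0 - a1)" "a1 = a3 + (a0 - a1) + 2 * (a4 - a3)"
    "a0 = a3 + 2 * (a0 - a1) + 2 * (a4 - a3)" "a5 = a3 + 2 * (a0 - a1) + (a4 - a3)"
  using assms by (smt (verit))+

text \<open>
  Two disjoint classes of particles on the integer line that are perfectly paired in all snapshots, such that any two particles of
  different classes meet. For \<open>r \<ge> 4\<close> the meetings along an alternating chain are linear equations that force
  its first two particles to coincide; for \<open>r = 3\<close> they leave the family of
  hexagons.
\<close>

lemma integer_grid_rigid:
  fixes A B :: "(int \<times> int) set"
  assumes r: "3 \<le> r" and fin: "finite A" and ne: "A \<noteq> {}"
    and inj: "\<And>k. k < r \<Longrightarrow> inj_on (position k) A" "\<And>k. k < r \<Longrightarrow> inj_on (position k) B"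
    and same: "\<And>k. k < r \<Longrightarrow> position k ` A = position k ` B"
    and disj: "A \<inter> B = {}"
    and meet: "\<And>X Y. X \<in> A \<Longrightarrow> Y \<in> B \<Longrightarrow> \<exists>k<r. position k X = position k Y"
  shows "r = 3 \<and> (\<exists>a s t. 0 < s \<and> 0 < t \<and>
           {a, a + s, a + t, a + s + 2 * t, a + 2 * s + t, a + 2 * s + 2 * t} \<subseteq> snd ` (A \<union> B))"
proof -
  let ?f = "cyclic_position r"
  have cinj: "inj_on (?f k) A" "inj_on (?f k) B" if "k < 5" for k
    using inj[of k] inj[of "k - r"] that r unfolding cyclic_position_def inj_on_def by auto
  have csame: "?f k ` A = ?f k ` B" if k: "k < 5" for k
  proof (cases "k < r")
    case True
    then show ?thesis using same[of k] unfolding cyclic_position_def by auto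
  next
    case False
    then have "k - r < r" using k r by linarith
    from same[OF this] have "uminus ` position (k - r) ` A = uminus ` position (k - r) ` B" by simp
    then show ?thesis using False unfolding cyclic_position_def by (simp add: image_image)
  qed
  have sep: "?f l X \<noteq> ?f l Y"
    if kl: "k < l" "l < k + 3" "l < 5" and XY: "X \<in> A" "Y \<in> B" and eq: "?f k X = ?f k Y" for k l X Y
  proof
    assume eq': "?f l X = ?f l Y"
    define k' where "k' = (if k < r then k else k - r)"
    define l' where "l' = (if l < r then l else l - r)"
    have "position k' X = position k' Y" "position l' X = position l' Y"
      using eq eq' unfolding k'_def l'_def cyclic_position_def by auto
    moreover have "k' \<noteq> l'" using kl r unfolding k'_def l'_def by auto
    ultimately have "(int (snapshot_time k') - int (snapshot_time l')) * (snd X - snd Y) = 0"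
      "fst X - fst Y = int (snapshot_time k') * (snd Y - snd X)"
      unfolding position_def by (auto simp: algebra_simps)
    moreover have "int (snapshot_time k') \<noteq> int (snapshot_time l')" using \<open>k' \<noteq> l'\<close> snapshot_time_inj by simp
    ultimately have "X = Y" by (auto simp: prod_eq_iff)
    then show False using XY disj by auto
  qed
  have nocross: "?f (Suc k) X \<le> ?f (Suc k) Y"
    if k: "k < 4" and XY: "X \<in> A \<and> Y \<in> B \<or> X \<in> B \<and> Y \<in> A" and lt: "?f k X < ?f k Y" for k X Y
  proof -
    obtain m where "m < r" "position m X = position m Y" using meet XY by metis
    from no_crossing_between_consecutive_times[OF _ this _ lt] show ?thesis using r k by auto
  qed
  have f_eq: "?f 0 P = fst P" "?f 1 P = fst P + snd P" "?f 2 P = fst P + 2 * snd P"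
     "?f 3 P = (if r = 3 then - fst P else fst P + 3 * snd P)"
     "?f 4 P = (if r = 3 then - (fst P + snd P) else if r = 4 then - fst P else fst P + 5 * snd P)" for P
    using r unfolding cyclic_position_def position_def snapshot_time_def by auto
  have swap: "?f (Suc (Suc k)) Y < ?f (Suc (Suc k)) X"
    if k: "k < 3" and lt: "?f k X < ?f k Y" and eq: "?f (Suc k) X = ?f (Suc k) Y" for k X Y
  proof -
    have "k = 0 \<or> k = 1 \<or> k = 2" using k by auto
    then show ?thesis
      using lt eq f_eq[of X] f_eq[of Y]
      by (elim disjE; simp add: eval_nat_numeral split: if_splits)
  qed
  have chain: "\<exists>p :: nat \<Rightarrow> int \<times> int.
     ((p 0 \<in> A \<and> p 1 \<in> B \<and> p 2 \<in> A \<and> p 3 \<in> B \<and> p 4 \<in> A \<and> p 5 \<in> B) \<or>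
      (p 0 \<in> B \<and> p 1 \<in> A \<and> p 2 \<in> B \<and> p 3 \<in> A \<and> p 4 \<in> B \<and> p 5 \<in> A)) \<and>
     ?f 0 (p 0) = ?f 0 (p 1) \<and> ?f 1 (p 1) = ?f 1 (p 2) \<and> ?f 2 (p 2) = ?f 2 (p 3) \<and>
     ?f 3 (p 3) = ?f 3 (p 4) \<and> ?f 4 (p 4) = ?f 4 (p 5) \<and>
     ?f 1 (p 0) = ?f 1 (p 3) \<and> ?f 2 (p 1) = ?f 2 (p 4) \<and> ?f 3 (p 2) = ?f 3 (p 5) \<and>
     ?f 2 (p 0) = ?f 2 (p 5) \<and>
     ?f 1 (p 1) < ?f 1 (p 0) \<and> ?f 4 (p 4) < ?f 4 (p 3)"
  proof (rule alternating_chain[of A ?f B])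
    show "?f (Suc k) X \<le> ?f (Suc k) Y"
      if "k < 4" "X \<in> A" "Y \<in> B" "?f k X < ?f k Y" for k X Y
      using nocross that by blast
    show "?f (Suc k) Y \<le> ?f (Suc k) X"
      if "k < 4" "X \<in> A" "Y \<in> B" "?f k Y < ?f k X" for k X Y
      using nocross that by blast
  qed (fact fin ne cinj csame sep swap)+
  obtain p :: "nat \<Rightarrow> int \<times> int" where p:
     "(p 0 \<in> A \<and> p 1 \<in> B \<and> p 2 \<in> A \<and> p 3 \<in> B \<and> p 4 \<in> A \<and> p 5 \<in> B) \<or>
      (p 0 \<in> B \<and> p 1 \<in> A \<and> p 2 \<in> B \<and> p 3 \<in> A \<and> p 4 \<in> B \<and> p 5 \<in> A)"
     "?f 0 (p 0) = ?f 0 (p 1)" "?f 1 (p 1) = ?f 1 (p 2)" "?f 2 (p 2) = ?f 2 (p 3)"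
     "?f 3 (p 3) = ?f 3 (p 4)" "?f 4 (p 4) = ?f 4 (p 5)"
     "?f 1 (p 0) = ?f 1 (p 3)" "?f 2 (p 1) = ?f 2 (p 4)" "?f 3 (p 2) = ?f 3 (p 5)"
     "?f 2 (p 0) = ?f 2 (p 5)"
     "?f 1 (p 1) < ?f 1 (p 0)" "?f 4 (p 4) < ?f 4 (p 3)"
    using chain by blast
  have r3: "r = 3"
  proof (rule ccontr)
    assume n3: "r \<noteq> 3"
    show False
    \<comment> \<open>for \<open>r = 4\<close> the fifth snapshot is the negated first one\<close>
    proof (cases "r = 4")
      case True
      then have f_eq': "?f 3 P = fst P + 3 * snd P" "?f 4 P = - fst P" for P
        using f_eq(4,5)[of P] by auto
      show False using p(2-11) unfolding f_eq(1-3) f_eq' by linarith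
    next
      case False
      then have f_eq': "?f 3 P = fst P + 3 * snd P" "?f 4 P = fst P + 5 * snd P" for P
        using n3 f_eq(4,5)[of P] by auto
      show False using p(2-11) unfolding f_eq(1-3) f_eq' by linarith
    qed
  qed
  then have f_eq': "?f 3 P = - fst P" "?f 4 P = - (fst P + snd P)" for P
    using f_eq(4,5)[of P] by auto
  define a where "a = snd (p 3)"
  define s where "s = snd (p 0) - snd (p 1)"
  define t where "t = snd (p 4) - snd (p 3)"
  note eqs = p(2-10)[unfolded f_eq(1-3) f_eq']
  have snds: "snd (p 2) = a + s" "snd (p 1) = a + s + 2 * t"
      "snd (p 0) = a + 2 * s + 2 * t" "snd (p 5) = a + 2 * s + t"
    unfolding a_def s_def t_def by (rule hexagon_of_meetings[OF eqs])+
  have p4: "snd (p 4) = a + t" unfolding a_def t_def by simp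
  have s0: "0 < s" using p(11) eqs(1) unfolding f_eq s_def by simp
  have t0: "0 < t" using p(12) eqs(4) unfolding f_eq' t_def by simp
  define V where "V = snd ` (A \<union> B)"
  have "snd (p 0) \<in> V" "snd (p 1) \<in> V" "snd (p 2) \<in> V" "snd (p 3) \<in> V" "snd (p 4) \<in> V" "snd (p 5) \<in> V"
    unfolding V_def using p(1) by blast+
  then have "{a, a + s, a + t, a + s + 2 * t, a + 2 * s + t, a + 2 * s + 2 * t} \<subseteq> V"
    unfolding snds p4 a_def[symmetric] by simp
  then show ?thesis using r3 s0 t0 unfolding V_def by blast
qed

section \<open>The hypergraph of uniform motions\<close>

text \<open>
  Vertices are numbered such that \<open>k m, \<dots>, k m + m - 1\<close> is the \<open>k\<close>-th copy of \<open>\<int>/m\<close>.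
\<close>

definition row :: "nat \<Rightarrow> nat \<Rightarrow> nat \<times> nat \<Rightarrow> nat" where
  "row m k P = (fst P + snapshot_time k * snd P) mod m"

definition edge :: "nat \<Rightarrow> nat \<Rightarrow> nat \<times> nat \<Rightarrow> nat set" where
  "edge r m P = (\<lambda>k. k * m + row m k P) ` {..<r}"

definition translates :: "nat \<Rightarrow> nat \<Rightarrow> nat set \<Rightarrow> nat set set" where
  "translates r m S = edge r m ` ({..<m} \<times> S)"

lemma row_eq_iff_dvd:
  "row m k P = row m k Q \<longleftrightarrow>
     int m dvd (int (fst P) + int (snapshot_time k) * int (snd P)) - (int (fst Q) + int (snapshot_time k) * int (snd Q))"
proof -
  have "row m k P = row m k Q \<longleftrightarrow> int (row m k P) = int (row m k Q)" by simp
  also have "\<dots> \<longleftrightarrow> (int (fst P) + int (snapshot_time k) * int (snd P)) mod int m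
      = (int (fst Q) + int (snapshot_time k) * int (snd Q)) mod int m"
    unfolding row_def by (simp add: zmod_int)
  finally show ?thesis by (simp only: mod_eq_dvd_iff)
qed

lemma row_less: "0 < m \<Longrightarrow> row m k P < m"
  unfolding row_def by simp

lemma in_edge_iff:
  assumes "0 < m"
  shows "v \<in> edge r m P \<longleftrightarrow> v div m < r \<and> v mod m = row m (v div m) P"
proof
  assume "v \<in> edge r m P"
  then obtain k where k: "k < r" "v = k * m + row m k P" unfolding edge_def by auto
  have "row m k P < m" using assms unfolding row_def by simp
  then show "v div m < r \<and> v mod m = row m (v div m) P" using k by simp
next
  assume v: "v div m < r \<and> v mod m = row m (v div m) P"
  have "v = (v div m) * m + row m (v div m) P" using v by (metis div_mult_mod_eq)
  then show "v \<in> edge r m P" using v unfolding edge_def by blast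
qed

lemma card_edge: "0 < m \<Longrightarrow> card (edge r m P) = r"
proof -
  assume m: "0 < m"
  have "inj_on (\<lambda>k. k * m + row m k P) {..<r}"
  proof (rule inj_on_inverseI)
    fix k
    have "row m k P < m" using m unfolding row_def by simp
    then show "(k * m + row m k P) div m = k" by simp
  qed
  then show ?thesis unfolding edge_def by (simp add: card_image)
qed

text \<open>
  Every vertex lies in exactly one edge of each matching, so its degree is the number of matchings.
\<close>

lemma regular_of_decomposable:
  assumes "decomposable_into_perfect_matchings V F"
  shows "regular_hypergraph V F"
proof -
  obtain N where N: "partition_on F N" "\<And>M. M \<in> N \<Longrightarrow> perfect_matching V F M"
    using assms unfolding decomposable_into_perfect_matchings_def by blast
  have "card {A\<in>F. v \<in> A} = card N" if v: "v \<in> V" for v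
  proof -
    define g where "g M = (THE A. A \<in> M \<and> v \<in> A)" for M
    have ex: "\<exists>!A. A \<in> M \<and> v \<in> A" if "M \<in> N" for M
      using N(2)[OF that] v unfolding perfect_matching_def by blast
    have g: "g M \<in> M" "v \<in> g M" if "M \<in> N" for M
      using theI'[OF ex[OF that]] unfolding g_def by auto
    have "bij_betw g N {A\<in>F. v \<in> A}"
    proof (rule bij_betwI')
      fix M M' assume M: "M \<in> N" "M' \<in> N"
      have "M = M'" if "g M = g M'"
        using g(1)[OF M(1)] g(1)[OF M(2)] that partition_onD2[OF N(1)] M
        unfolding disjoint_def by auto
      then show "g M = g M' \<longleftrightarrow> M = M'" by auto
    next
      fix M assume "M \<in> N"
      then show "g M \<in> {A\<in>F. v \<in> A}" using g partition_onD1[OF N(1)] by auto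
    next
      fix A assume A: "A \<in> {A\<in>F. v \<in> A}"
      then obtain M where "M \<in> N" "A \<in> M" using partition_onD1[OF N(1)] by auto
      then show "\<exists>M\<in>N. A = g M" using ex[of M] g[of M] A by blast
    qed
    then show ?thesis by (simp add: bij_betw_same_card)
  qed
  then show ?thesis unfolding regular_hypergraph_def by blast
qed

text \<open>
  The form in which the property is used: among three nonzero integers of sum zero, two have the same sign and are
  the weights of a weighted average equal to the third variable.
\<close>

lemma convex_solution_freeD:
  fixes u v w :: int
  assumes free: "convex_solution_free L S" and abc: "a \<in> S" "b \<in> S" "c \<in> S"
    and sum: "u + v + w = 0" and ne: "u \<noteq> 0" "v \<noteq> 0" "w \<noteq> 0"
    and le: "\<bar>u\<bar> \<le> int L" "\<bar>v\<bar> \<le> int L" "\<bar>w\<bar> \<le> int L"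
    and eq: "u * int a + v * int b + w * int c = 0"
  shows "a = b"
proof -
  have pos: "a = b \<and> b = c"
    if "a \<in> S" "b \<in> S" "c \<in> S" "0 < u" "0 < v" "u + v \<le> int L"
      and eq: "u * int a + v * int b = (u + v) * int c" for a b c and u v :: int
  proof -
    have "int (nat u * a + nat v * b) = int ((nat u + nat v) * c)" using eq that(4,5) by simp
    then have "nat u * a + nat v * b = (nat u + nat v) * c" by (simp only: of_nat_eq_iff)
    moreover have "0 < nat u" "0 < nat v" "nat u + nat v \<le> L" using that(4-6) by linarith+
    ultimately have "a = b" using free that(1-3) unfolding convex_solution_free_def by blast
    moreover from this have "b = c" using eq that(4,5) by (simp flip: distrib_right)
    ultimately show ?thesis by simp
  qed
  consider "0 < u" "0 < v" | "u < 0" "v < 0" | "0 < u" "0 < w" | "u < 0" "w < 0" | "0 < v" "0 < w" | "v < 0" "w < 0"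
    using ne sum by linarith
  then show ?thesis
  proof cases
    case 1
    have "u * int a + v * int b = (u + v) * int c" using eq sum by algebra
    then show ?thesis using pos[of a b c u v] abc 1 le sum by auto
  next
    case 2
    have "- u * int a + - v * int b = (- u + - v) * int c" using eq sum by algebra
    then show ?thesis using pos[of a b c "- u" "- v"] abc 2 le sum by auto
  next
    case 3
    have "u * int a + w * int c = (u + w) * int b" using eq sum by algebra
    then show ?thesis using pos[of a c b u w] abc 3 le sum by auto
  next
    case 4
    have "- u * int a + - w * int c = (- u + - w) * int b" using eq sum by algebra
    then show ?thesis using pos[of a c b "- u" "- w"] abc 4 le sum by auto
  next
    case 5
    have "v * int b + w * int c = (v + w) * int a" using eq sum by algebra
    then show ?thesis using pos[of b c a v w] abc 5 le sum by auto
  next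
    case 6
    have "- v * int b + - w * int c = (- v + - w) * int a" using eq sum by algebra
    then show ?thesis using pos[of b c a "- v" "- w"] abc 6 le sum by auto
  qed
qed

lemma multiple_less_modulus:
  fixes z :: int
  assumes "int m dvd z" and "\<bar>z\<bar> < int m"
  shows "z = 0"
  using dvd_imp_le_int[of z "int m"] assms by linarith

text \<open>
  The factor \<open>4 r\<close> prevents reduction modulo \<open>m\<close> from creating spurious solutions: the velocities enter congruences only via sums of at
  most four terms \<open>c (a - b)\<close> with \<open>|c| \<le> r\<close>, so each such congruence is an equality of integers. The bound \<open>r + 1\<close> covers the
  differences of times, which are at most \<open>r\<close>, and for \<open>r = 3\<close> the weights \<open>3 + 1\<close> of degenerate hexagons.
\<close>

locale translate_hypergraph =
  fixes r m M :: nat and S :: "nat set"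
  assumes r3: "3 \<le> r" and m0: "0 < m" and no_wrap: "4 * r * M \<le> m" and S: "S \<subseteq> {..<M}"
    and convex_free: "convex_solution_free (Suc r) S"
    and hex_free: "r = 3 \<Longrightarrow> hexagon_free S"
begin

lemma small_term:
  assumes "a \<in> S" "b \<in> S" and "\<bar>c\<bar> \<le> int r"
  shows "\<bar>c * (int a - int b)\<bar> < int (r * M)"
proof -
  have "a < M" "b < M" using S assms(1,2) by auto
  then have "\<bar>int a - int b\<bar> < int M" by linarith
  then have "int r * \<bar>int a - int b\<bar> < int r * int M"
    using r3 by (intro mult_strict_left_mono) auto
  moreover have "\<bar>c * (int a - int b)\<bar> \<le> int r * \<bar>int a - int b\<bar>"
    unfolding abs_mult using assms(3) by (rule mult_right_mono) simp
  ultimately show ?thesis by simp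
qed

lemma no_wrap_int: "4 * int (r * M) \<le> int m"
proof -
  have "int (4 * (r * M)) \<le> int m" using no_wrap by (simp only: of_nat_le_iff mult.assoc)
  then show ?thesis by simp
qed

lemma snapshot_time_diff: "k < r \<Longrightarrow> l < r \<Longrightarrow> \<bar>int (snapshot_time k) - int (snapshot_time l)\<bar> \<le> int r"
  using snapshot_time_le[of k r] snapshot_time_le[of l r] by auto

lemma same_row_same_slope:
  assumes "P \<in> {..<m} \<times> S" "Q \<in> {..<m} \<times> S" and "snd P = snd Q" and "row m k P = row m k Q"
  shows "P = Q"
proof -
  have "int m dvd int (fst P) - int (fst Q)" using assms(3,4) unfolding row_eq_iff_dvd by simp
  moreover have "\<bar>int (fst P) - int (fst Q)\<bar> < int m" using assms(1,2) by auto
  ultimately have "int (fst P) - int (fst Q) = 0" by (rule multiple_less_modulus)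
  then show ?thesis using assms(3) by (simp add: prod_eq_iff)
qed

lemma two_rows:
  assumes P: "P \<in> {..<m} \<times> S" and Q: "Q \<in> {..<m} \<times> S"
    and kl: "k < r" "l < r" "k \<noteq> l" and rows: "row m k P = row m k Q" "row m l P = row m l Q"
  shows "P = Q"
proof -
  let ?z = "(int (snapshot_time k) - int (snapshot_time l)) * (int (snd P) - int (snd Q))"
  have "int m dvd ?z"
    using dvd_diff[OF rows[unfolded row_eq_iff_dvd]] by (simp add: algebra_simps)
  moreover have "\<bar>?z\<bar> < int m"
  proof -
    have "\<bar>?z\<bar> < int (r * M)"
      using P Q kl by (intro small_term snapshot_time_diff) auto
    then show ?thesis using no_wrap_int by linarith
  qed
  ultimately have "?z = 0" by (rule multiple_less_modulus)
  then have "snd P = snd Q" using kl(3) by (simp add: snapshot_time_inj)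
  then show ?thesis by (rule same_row_same_slope[OF P Q _ rows(1)])
qed

lemma inj_edge: "inj_on (edge r m) ({..<m} \<times> S)"
proof (rule inj_onI)
  fix P Q assume PQ: "P \<in> {..<m} \<times> S" "Q \<in> {..<m} \<times> S" "edge r m P = edge r m Q"
  have "row m k P = row m k Q" if "k < r" for k
  proof -
    have row: "row m k P < m" using m0 unfolding row_def by simp
    have "k * m + row m k P \<in> edge r m Q" using PQ(3) that unfolding edge_def by auto
    then show ?thesis using row m0 by (simp add: in_edge_iff)
  qed
  then show "P = Q" using two_rows[OF PQ(1,2), of 0 1] r3 by simp
qed

lemma common_vertex:
  assumes P: "P \<in> {..<m} \<times> S" and Q: "Q \<in> {..<m} \<times> S" and "P \<noteq> Q"
    and k: "k < r" "row m k P = row m k Q"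
  shows "edge r m P \<inter> edge r m Q = {k * m + row m k P}"
proof -
  have "v = k * m + row m k P" if "v \<in> edge r m P" "v \<in> edge r m Q" for v
  proof -
    have v: "v div m < r" "v mod m = row m (v div m) P" "v mod m = row m (v div m) Q"
      using that m0 by (auto simp: in_edge_iff)
    then have "v div m = k" using two_rows[OF P Q _ k(1) _ _ k(2)] \<open>P \<noteq> Q\<close> by metis
    then show ?thesis using v(2) by (metis div_mult_mod_eq)
  qed
  moreover have "k * m + row m k P \<in> edge r m P" "k * m + row m k P \<in> edge r m Q"
    using k m0 row_less[of m k P] by (auto simp: in_edge_iff)
  ultimately show ?thesis by blast
qed

lemma meeting_row:
  assumes "edge r m P \<inter> edge r m Q \<noteq> {}"
  obtains k where "k < r" "row m k P = row m k Q"
proof -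
  obtain v where "v \<in> edge r m P" "v \<in> edge r m Q" using assms by auto
  then show thesis using that[of "v div m"] m0 by (auto simp: in_edge_iff)
qed

lemma linear: "linear_hypergraph (translates r m S)"
  unfolding linear_hypergraph_def
proof (intro ballI impI)
  fix A B assume AB: "A \<in> translates r m S" "B \<in> translates r m S" "A \<noteq> B"
  then obtain P Q where PQ: "P \<in> {..<m} \<times> S" "Q \<in> {..<m} \<times> S" "A = edge r m P" "B = edge r m Q"
    unfolding translates_def by auto
  show "card (A \<inter> B) \<le> 1"
  proof (cases "A \<inter> B = {}")
    case False
    then obtain k where "k < r" "row m k P = row m k Q" using meeting_row PQ by metis
    then show ?thesis using common_vertex[OF PQ(1,2)] AB(3) PQ by fastforce
  qed simp
qed

text \<open>
  Adding the three meeting conditions eliminates the starting points. What remains is an equation between the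
  velocities with coefficients \<open>c\<^sub>i - c\<^sub>k\<close>, \<open>c\<^sub>j - c\<^sub>i\<close>, \<open>c\<^sub>k - c\<^sub>j\<close> of sum zero.
\<close>

lemma no_triangle: "\<not> contains_triangle (translates r m S)"
proof
  assume "contains_triangle (translates r m S)"
  then obtain C1 C2 C3 where C: "C1 \<in> translates r m S" "C2 \<in> translates r m S" "C3 \<in> translates r m S"
    and tri: "is_triangle C1 C2 C3" unfolding contains_triangle_def by blast
  obtain P1 P2 P3 where P: "P1 \<in> {..<m} \<times> S" "P2 \<in> {..<m} \<times> S" "P3 \<in> {..<m} \<times> S"
    and E: "C1 = edge r m P1" "C2 = edge r m P2" "C3 = edge r m P3"
    using C unfolding translates_def by auto
  have ne: "P1 \<noteq> P2" "P2 \<noteq> P3" "P3 \<noteq> P1" and corner: "C1 \<inter> C2 \<noteq> C1 \<inter> C3"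
    using tri E unfolding is_triangle_def by auto
  have "C1 \<inter> C2 \<noteq> {}" "C2 \<inter> C3 \<noteq> {}" "C3 \<inter> C1 \<noteq> {}"
    using tri unfolding is_triangle_def by auto
  then obtain i j k where i: "i < r" "row m i P1 = row m i P2"
    and j: "j < r" "row m j P2 = row m j P3" and k: "k < r" "row m k P3 = row m k P1"
    unfolding E by (metis meeting_row)
  have C12: "C1 \<inter> C2 = {l * m + row m l P1}" if "l < r" "row m l P1 = row m l P2" for l
    unfolding E by (rule common_vertex[OF P(1,2) ne(1) that])
  have C13: "C1 \<inter> C3 = {l * m + row m l P1}" if "l < r" "row m l P1 = row m l P3" for l
    unfolding E by (rule common_vertex[OF P(1,3) ne(3)[symmetric] that])
  \<comment> \<open>equal times would make all three edges pass through one vertex\<close>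
  have "i \<noteq> k"
    using corner unfolding C12[OF i] C13[OF k(1) k(2)[symmetric]] by metis
  moreover have "i \<noteq> j"
  proof
    assume eq: "i = j"
    have "row m i P1 = row m i P3" using trans[OF i(2) j(2)[folded eq]] .
    then show False using corner unfolding C12[OF i] C13[OF i(1) \<open>row m i P1 = row m i P3\<close>] by metis
  qed
  moreover have "j \<noteq> k"
  proof
    assume eq: "j = k"
    have "row m k P1 = row m k P2" using trans[OF j(2)[unfolded eq] k(2)] by (rule sym)
    then show False
      using corner unfolding C12[OF k(1) \<open>row m k P1 = row m k P2\<close>] C13[OF k(1) k(2)[symmetric]] by metis
  qed
  ultimately have distinct: "i \<noteq> k" "j \<noteq> i" "k \<noteq> j" by metis+
  define c where "c l = int (snapshot_time l)" for l
  define u where "u = c i - c k"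
  define v where "v = c j - c i"
  define w where "w = c k - c j"
  have uvw: "u + v + w = 0" "u \<noteq> 0" "v \<noteq> 0" "w \<noteq> 0" "\<bar>u\<bar> \<le> int r" "\<bar>v\<bar> \<le> int r" "\<bar>w\<bar> \<le> int r"
    unfolding u_def v_def w_def c_def using distinct snapshot_time_diff i j k by (auto simp: snapshot_time_inj)
  let ?a = "\<lambda>P. int (snd P)"
  have slopes: "snd P1 \<in> S" "snd P2 \<in> S" "snd P3 \<in> S" using P by auto
  have sum: "u * ?a P1 + v * ?a P2 + w * ?a P3 = u * (?a P1 - ?a P3) + v * (?a P2 - ?a P3)"
    using uvw(1) by algebra
  have "int m dvd u * ?a P1 + v * ?a P2 + w * ?a P3"
    using dvd_add[OF dvd_add[OF i(2)[unfolded row_eq_iff_dvd] j(2)[unfolded row_eq_iff_dvd]]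
        k(2)[unfolded row_eq_iff_dvd]]
    unfolding u_def v_def w_def c_def by (simp add: algebra_simps)
  moreover have "\<bar>u * ?a P1 + v * ?a P2 + w * ?a P3\<bar> < int m"
  proof -
    have "\<bar>u * (?a P1 - ?a P3)\<bar> < int (r * M)" "\<bar>v * (?a P2 - ?a P3)\<bar> < int (r * M)"
      by (intro small_term slopes uvw)+
    then show ?thesis unfolding sum using no_wrap_int by linarith
  qed
  ultimately have "u * ?a P1 + v * ?a P2 + w * ?a P3 = 0" by (rule multiple_less_modulus)
  then have "snd P1 = snd P2"
    using slopes uvw by (intro convex_solution_freeD[OF convex_free, of "snd P1" "snd P2" "snd P3" u v w]) auto
  then have "P1 = P2" by (rule same_row_same_slope[OF P(1,2) _ i(2)])
  then show False using ne by simp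
qed

end

context translate_hypergraph begin

text \<open>
  The starting points are lifted to integers along a spanning tree of the meetings: \<open>y j\<close> via the meeting of \<open>B j\<close> with
  \<open>A 1\<close>, and then \<open>x i\<close> via the meeting of \<open>A i\<close> with \<open>B 1\<close>. Any further meeting closes a cycle of length four, whose velocity terms are
  too small for a nonzero multiple of \<open>m\<close>; so it is a meeting of the lifted particles. The times of the meetings form a Latin square,
  as edges of the same class are disjoint.
\<close>

lemma no_grid: "\<not> contains_grid r (translates r m S)"
proof
  assume "contains_grid r (translates r m S)"
  then obtain A B where AB: "A ` {1..r} \<subseteq> translates r m S" "B ` {1..r} \<subseteq> translates r m S"
    and grid: "is_grid r A B" unfolding contains_grid_def by blast
  have disjA: "i = j" if "i \<in> {1..r}" "j \<in> {1..r}" "A i \<inter> A j \<noteq> {}" for i j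
    using grid that unfolding is_grid_def by (metis Int_commute linorder_neqE_nat)
  have disjB: "i = j" if "i \<in> {1..r}" "j \<in> {1..r}" "B i \<inter> B j \<noteq> {}" for i j
    using grid that unfolding is_grid_def by (metis Int_commute linorder_neqE_nat)
  have AB_ne: "A i \<noteq> B j" if "i \<in> {1..r}" "j \<in> {1..r}" for i j
    using grid that unfolding is_grid_def by blast
  have AB_meet: "A i \<inter> B j \<noteq> {}" if "i \<in> {1..r}" "j \<in> {1..r}" for i j
  proof -
    have "card (A i \<inter> B j) = 1" using grid that unfolding is_grid_def by blast
    then show ?thesis by auto
  qed
  have "\<forall>i\<in>{1..r}. \<exists>P. P \<in> {..<m} \<times> S \<and> A i = edge r m P" "\<forall>i\<in>{1..r}. \<exists>P. P \<in> {..<m} \<times> S \<and> B i = edge r m P"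
    using AB unfolding translates_def by blast+
  then obtain P Q where
    P: "\<And>i. i \<in> {1..r} \<Longrightarrow> P i \<in> {..<m} \<times> S" "\<And>i. i \<in> {1..r} \<Longrightarrow> A i = edge r m (P i)" and
    Q: "\<And>i. i \<in> {1..r} \<Longrightarrow> Q i \<in> {..<m} \<times> S" "\<And>i. i \<in> {1..r} \<Longrightarrow> B i = edge r m (Q i)"
    by (metis (no_types))
  have same_rowA: "i = j" if "i \<in> {1..r}" "j \<in> {1..r}" "k < r" "row m k (P i) = row m k (P j)" for i j k
  proof -
    have "k * m + row m k (P i) \<in> A i \<inter> A j"
      using that P m0 by (simp add: in_edge_iff row_less)
    then show ?thesis using disjA that by blast
  qed
  have same_rowB: "i = j" if "i \<in> {1..r}" "j \<in> {1..r}" "k < r" "row m k (Q i) = row m k (Q j)" for i j k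
  proof -
    have "k * m + row m k (Q i) \<in> B i \<inter> B j"
      using that Q m0 by (simp add: in_edge_iff row_less)
    then show ?thesis using disjB that by blast
  qed
  have "\<exists>k<r. row m k (P i) = row m k (Q j)" if "i \<in> {1..r}" "j \<in> {1..r}" for i j
    using AB_meet[OF that] P(2)[OF that(1)] Q(2)[OF that(2)] meeting_row[of "P i" "Q j"] by metis
  \<comment> \<open>the time at which \<open>A i\<close> and \<open>B j\<close> meet\<close>
  then obtain t where t: "\<And>i j. i \<in> {1..r} \<Longrightarrow> j \<in> {1..r} \<Longrightarrow> t i j < r"
      "\<And>i j. i \<in> {1..r} \<Longrightarrow> j \<in> {1..r} \<Longrightarrow> row m (t i j) (P i) = row m (t i j) (Q j)"
    by metis
  define a where "a i = int (snd (P i))" for i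
  define b where "b j = int (snd (Q j))" for j
  define c where "c k = int (snapshot_time k)" for k
  define y where "y j = int (fst (P 1)) + c (t 1 j) * (a 1 - b j)" for j
  define x where "x i = y 1 + c (t i 1) * (b 1 - a i)" for i
  have one: "1 \<in> {1..r}" using r3 by simp
  have rowPQ: "int m dvd (int (fst (P i)) + c (t i j) * a i) - (int (fst (Q j)) + c (t i j) * b j)"
    if "i \<in> {1..r}" "j \<in> {1..r}" for i j
    using t(2)[OF that] unfolding row_eq_iff_dvd a_def b_def c_def .
  have y: "int m dvd y j - int (fst (Q j))" if "j \<in> {1..r}" for j
    using rowPQ[OF one that] unfolding y_def by (simp add: algebra_simps)
  have x: "int m dvd x i - int (fst (P i))" if "i \<in> {1..r}" for i
  proof -
    have eq: "x i - int (fst (P i)) = (y 1 - int (fst (Q 1)))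
        - ((int (fst (P i)) + c (t i 1) * a i) - (int (fst (Q 1)) + c (t i 1) * b 1))"
      unfolding x_def by (simp add: algebra_simps)
    show ?thesis unfolding eq by (rule dvd_diff[OF y[OF one] rowPQ[OF that one]])
  qed
  define X where "X i = (x i, a i)" for i
  define Y where "Y j = (y j, b j)" for j
  have posX: "int m dvd position k (X i) - (int (fst (P i)) + int (snapshot_time k) * int (snd (P i)))"
    if "i \<in> {1..r}" for i k
    using x[OF that] unfolding X_def position_def a_def by simp
  have posY: "int m dvd position k (Y j) - (int (fst (Q j)) + int (snapshot_time k) * int (snd (Q j)))"
    if "j \<in> {1..r}" for j k
    using y[OF that] unfolding Y_def position_def b_def by simp
  have meet: "position (t i j) (X i) = position (t i j) (Y j)" if ij: "i \<in> {1..r}" "j \<in> {1..r}" for i j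
  proof -
    let ?k = "t i j"
    have "int m dvd (position ?k (X i) - (int (fst (P i)) + int (snapshot_time ?k) * int (snd (P i))))
       - (position ?k (Y j) - (int (fst (Q j)) + int (snapshot_time ?k) * int (snd (Q j))))
       + ((int (fst (P i)) + int (snapshot_time ?k) * int (snd (P i))) - (int (fst (Q j)) + int (snapshot_time ?k) * int (snd (Q j))))"
      by (rule dvd_add[OF dvd_diff[OF posX[OF ij(1)] posY[OF ij(2)]] t(2)[OF ij, unfolded row_eq_iff_dvd]])
    then have "int m dvd position ?k (X i) - position ?k (Y j)" by simp
    moreover have "\<bar>position ?k (X i) - position ?k (Y j)\<bar> < int m"
    proof -
      have expand: "position ?k (X i) - position ?k (Y j) =
         c (t 1 1) * (a 1 - b 1) + c (t i 1) * (b 1 - a i) - c (t 1 j) * (a 1 - b j) + c ?k * (a i - b j)"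
        unfolding X_def Y_def position_def x_def y_def c_def by (simp add: algebra_simps)
      have cr: "\<bar>c (t i' j')\<bar> \<le> int r" if "i' \<in> {1..r}" "j' \<in> {1..r}" for i' j'
        using snapshot_time_le[OF t(1)[OF that]] unfolding c_def by simp
      have inS: "snd (P i') \<in> S" "snd (Q i') \<in> S" if "i' \<in> {1..r}" for i'
        using P(1)[OF that] Q(1)[OF that] by auto
      have "\<bar>c (t 1 1) * (a 1 - b 1)\<bar> < int (r * M)" "\<bar>c (t i 1) * (b 1 - a i)\<bar> < int (r * M)"
        "\<bar>c (t 1 j) * (a 1 - b j)\<bar> < int (r * M)" "\<bar>c ?k * (a i - b j)\<bar> < int (r * M)"
        unfolding a_def b_def by (intro small_term inS cr one ij)+
      then show ?thesis unfolding expand using no_wrap_int by linarith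
    qed
    ultimately have "position ?k (X i) - position ?k (Y j) = 0" by (rule multiple_less_modulus)
    then show ?thesis by simp
  qed
  have cancel: "int m dvd u - v" if "int m dvd z - u" "int m dvd z - v" for u v z
  proof -
    have "(z - v) - (z - u) = u - v" by simp
    then show ?thesis using dvd_diff[OF that(2,1)] by metis
  qed
  have backX: "row m k (P i) = row m k (P j)"
    if "i \<in> {1..r}" "j \<in> {1..r}" "position k (X i) = position k (X j)" for i j k
    unfolding row_eq_iff_dvd
    by (rule cancel[OF posX[OF that(1), of k] posX[OF that(2), of k, folded that(3)]])
  have backY: "row m k (Q i) = row m k (Q j)"
    if "i \<in> {1..r}" "j \<in> {1..r}" "position k (Y i) = position k (Y j)" for i j k
    unfolding row_eq_iff_dvd
    by (rule cancel[OF posY[OF that(1), of k] posY[OF that(2), of k, folded that(3)]])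
  have backXY: "row m k (P i) = row m k (Q j)"
    if "i \<in> {1..r}" "j \<in> {1..r}" "position k (X i) = position k (Y j)" for i j k
    unfolding row_eq_iff_dvd
    by (rule cancel[OF posX[OF that(1), of k] posY[OF that(2), of k, folded that(3)]])
  have latin_row: "t i ` {1..r} = {..<r}" if i: "i \<in> {1..r}" for i
  proof (rule card_subset_eq)
    have "inj_on (t i) {1..r}"
    proof (rule inj_onI)
      fix j j' assume j: "j \<in> {1..r}" "j' \<in> {1..r}" "t i j = t i j'"
      have "row m (t i j) (Q j) = row m (t i j) (Q j')"
        using t(2)[OF i j(1)] t(2)[OF i j(2)] j(3) by simp
      then show "j = j'" using same_rowB[OF j(1,2) t(1)[OF i j(1)]] by blast
    qed
    then show "card (t i ` {1..r}) = card {..<r}" by (simp add: card_image)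
  qed (use t(1) i in auto)
  have latin_column: "(\<lambda>i. t i j) ` {1..r} = {..<r}" if j: "j \<in> {1..r}" for j
  proof (rule card_subset_eq)
    have "inj_on (\<lambda>i. t i j) {1..r}"
    proof (rule inj_onI)
      fix i i' assume i: "i \<in> {1..r}" "i' \<in> {1..r}" "t i j = t i' j"
      have "row m (t i j) (P i) = row m (t i j) (P i')"
        using t(2)[OF i(1) j] t(2)[OF i(2) j] i(3) by simp
      then show "i = i'" using same_rowA[OF i(1,2) t(1)[OF i(1) j]] by blast
    qed
    then show "card ((\<lambda>i. t i j) ` {1..r}) = card {..<r}" by (simp add: card_image)
  qed (use t(1) j in auto)
  have rigid: "r = 3 \<and> (\<exists>a s t. 0 < s \<and> 0 < t \<and>
      {a, a + s, a + t, a + s + 2 * t, a + 2 * s + t, a + 2 * s + 2 * t} \<subseteq> snd ` (X ` {1..r} \<union> Y ` {1..r}))"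
  proof (rule integer_grid_rigid[OF r3])
    fix k assume k: "k < r"
    show "inj_on (position k) (X ` {1..r})"
    proof (rule inj_onI)
      fix U V assume "U \<in> X ` {1..r}" "V \<in> X ` {1..r}" and eq: "position k U = position k V"
      then obtain i j where ij: "i \<in> {1..r}" "j \<in> {1..r}" "U = X i" "V = X j" by blast
      then have "i = j" using same_rowA[OF ij(1,2) k backX[OF ij(1,2)]] eq by simp
      then show "U = V" using ij by simp
    qed
    show "inj_on (position k) (Y ` {1..r})"
    proof (rule inj_onI)
      fix U V assume "U \<in> Y ` {1..r}" "V \<in> Y ` {1..r}" and eq: "position k U = position k V"
      then obtain i j where ij: "i \<in> {1..r}" "j \<in> {1..r}" "U = Y i" "V = Y j" by blast
      then have "i = j" using same_rowB[OF ij(1,2) k backY[OF ij(1,2)]] eq by simp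
      then show "U = V" using ij by simp
    qed
    show "position k ` X ` {1..r} = position k ` Y ` {1..r}"
    proof
      show "position k ` X ` {1..r} \<subseteq> position k ` Y ` {1..r}"
      proof
        fix z assume "z \<in> position k ` X ` {1..r}"
        then obtain i where i: "i \<in> {1..r}" "z = position k (X i)" by (elim imageE) auto
        have "k \<in> t i ` {1..r}" unfolding latin_row[OF i(1)] using k by simp
        then obtain j where j: "k = t i j" "j \<in> {1..r}" by (rule imageE)
        have "z = position k (Y j)" using meet[OF i(1) j(2)] i(2) j(1) by simp
        then show "z \<in> position k ` Y ` {1..r}" using j(2) by (simp only: imageI)
      qed
      show "position k ` Y ` {1..r} \<subseteq> position k ` X ` {1..r}"
      proof
        fix z assume "z \<in> position k ` Y ` {1..r}"
        then obtain j where j: "j \<in> {1..r}" "z = position k (Y j)" by (elim imageE) auto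
        have "k \<in> (\<lambda>i. t i j) ` {1..r}" unfolding latin_column[OF j(1)] using k by simp
        then obtain i where i: "k = t i j" "i \<in> {1..r}" by (rule imageE)
        have "z = position k (X i)" using meet[OF i(2) j(1)] j(2) i(1) by simp
        then show "z \<in> position k ` X ` {1..r}" using i(2) by (simp only: imageI)
      qed
    qed
  next
    show "X ` {1..r} \<inter> Y ` {1..r} = {}"
    proof (rule ccontr)
      assume "X ` {1..r} \<inter> Y ` {1..r} \<noteq> {}"
      then obtain i j where ij: "i \<in> {1..r}" "j \<in> {1..r}" "X i = Y j" by blast
      have "row m k (P i) = row m k (Q j)" for k by (rule backXY[OF ij(1,2)]) (simp add: ij(3))
      then have "P i = Q j" using two_rows[OF P(1)[OF ij(1)] Q(1)[OF ij(2)], of 0 1] r3 by simp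
      then show False using AB_ne[OF ij(1,2)] P(2)[OF ij(1)] Q(2)[OF ij(2)] by simp
    qed
  next
    fix U V assume "U \<in> X ` {1..r}" "V \<in> Y ` {1..r}"
    then show "\<exists>k<r. position k U = position k V" using meet t(1) by blast
  qed (use one in auto)
  then obtain a0 s s' where hex: "0 < s" "0 < s'" and
     sub: "{a0, a0 + s, a0 + s', a0 + s + 2 * s', a0 + 2 * s + s', a0 + 2 * s + 2 * s'} \<subseteq> snd ` (X ` {1..r} \<union> Y ` {1..r})"
    by blast
  have r_eq: "r = 3" using rigid by blast
  have "snd ` (X ` {1..r} \<union> Y ` {1..r}) \<subseteq> int ` S"
    using P(1) Q(1) unfolding X_def Y_def a_def b_def by fastforce
  from subset_trans[OF sub this]
  have inS: "a0 \<in> int ` S" "a0 + s \<in> int ` S" "a0 + s' \<in> int ` S" "a0 + s + 2 * s' \<in> int ` S"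
      "a0 + 2 * s + s' \<in> int ` S" "a0 + 2 * s + 2 * s' \<in> int ` S"
    unfolding insert_subset by blast+
  obtain p where p: "a0 = int p" using inS(1) by (rule imageE)
  obtain u where u: "0 < u" "s = int u" using zero_less_imp_eq_int[OF hex(1)] by blast
  obtain v where v: "0 < v" "s' = int v" using zero_less_imp_eq_int[OF hex(2)] by blast
  have toS: "n \<in> S" if "int n \<in> int ` S" for n using that by auto
  have nats: "p \<in> S" "p + u \<in> S" "p + v \<in> S" "p + u + 2 * v \<in> S" "p + 2 * u + v \<in> S" "p + 2 * u + 2 * v \<in> S"
    using inS unfolding p u v
    by - (rule toS, simp only: of_nat_add of_nat_mult of_nat_numeral)+
  show False
  proof (cases "u = v")
    case True
    \<comment> \<open>the velocities \<open>p\<close>, \<open>p + u\<close> and \<open>p + 4 u\<close> of a degenerate hexagon\<close>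
    have "3 * p + 1 * (p + 2 * u + 2 * v) = (3 + 1) * (p + u)" using True by simp
    then have "p = p + 2 * u + 2 * v"
      using convex_free[unfolded convex_solution_free_def r_eq, rule_format, of 3 1 p "p + 2 * u + 2 * v" "p + u"]
        nats by simp
    then show False using u by simp
  next
    case False
    then show False using hex_free[OF r_eq] nats u(1) v(1) unfolding hexagon_free_def hexagon_def by blast
  qed
qed

lemma card_translates: "card (translates r m S) = m * card S"
  unfolding translates_def using inj_edge by (simp add: card_image card_cartesian_product)

lemma edge_subset: "edge r m P \<subseteq> {..<r * m}"
proof
  fix v assume "v \<in> edge r m P"
  then have "v div m < r" using m0 by (simp add: in_edge_iff)
  then show "v \<in> {..<r * m}" using m0 by (simp add: div_less_iff_less_mult)
qed

lemma linear_grid_triangle_free: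
  assumes "r * m \<le> n"
  shows "linear_grid_triangle_free r {..<n} (translates r m S)"
  unfolding linear_grid_triangle_free_def
proof (intro conjI linear no_grid no_triangle)
  have "edge r m P \<subseteq> {..<n}" for P
    using edge_subset[of P] assms by (meson lessThan_subset_iff order_trans)
  then show "hypergraph_on {..<n} (translates r m S)"
    unfolding hypergraph_on_def translates_def by auto
  show "uniform_hypergraph r (translates r m S)"
    unfolding uniform_hypergraph_def translates_def using card_edge[OF m0, of r] by (auto simp: edge_def)
qed

text \<open>
  The matchings are the classes of particles with equal velocity: at each snapshot such a class is a translate of
  \<open>\<int>/m\<close>.
\<close>

lemma decomposable: "decomposable_into_perfect_matchings {..<r * m} (translates r m S)"
  unfolding decomposable_into_perfect_matchings_def
proof (intro exI conjI ballI)
  let ?N = "\<lambda>a. (\<lambda>x. edge r m (x, a)) ` {..<m}"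
  have inj: "x = y \<and> a = b" if "x < m" "y < m" "a \<in> S" "b \<in> S" "edge r m (x, a) = edge r m (y, b)" for x y a b
    using inj_onD[OF inj_edge that(5)] that by auto
  show "partition_on (translates r m S) (?N ` S)"
    unfolding partition_on_def
  proof (intro conjI)
    show "\<Union> (?N ` S) = translates r m S" unfolding translates_def by auto
    show "disjoint (?N ` S)"
    proof (unfold disjoint_def, intro ballI impI)
      fix N N' assume "N \<in> ?N ` S" "N' \<in> ?N ` S" "N \<noteq> N'"
      then obtain a b where ab: "a \<in> S" "b \<in> S" "N = ?N a" "N' = ?N b" "a \<noteq> b" by blast
      then show "N \<inter> N' = {}" using inj[of _ _ a b] by auto
    qed
    show "{} \<notin> ?N ` S" using m0 by auto
  qed
  fix N assume "N \<in> ?N ` S"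
  then obtain a where a: "a \<in> S" "N = ?N a" by auto
  have "\<exists>!A. A \<in> N \<and> v \<in> A" if v: "v < r * m" for v
  proof -
    define k where "k = v div m"
    have k: "k < r" using v m0 unfolding k_def by (simp add: div_less_iff_less_mult)
    have v_in: "v \<in> edge r m (x, a) \<longleftrightarrow> row m k (x, a) = v mod m" for x
      using k m0 by (auto simp: in_edge_iff k_def)
    have rows_inj: "inj_on (\<lambda>x. row m k (x, a)) {..<m}"
    proof (rule inj_onI)
      fix x y assume "x \<in> {..<m}" "y \<in> {..<m}" "row m k (x, a) = row m k (y, a)"
      then show "x = y" using same_row_same_slope[of "(x, a)" "(y, a)" k] a by auto
    qed
    moreover have "(\<lambda>x. row m k (x, a)) ` {..<m} \<subseteq> {..<m}" using row_less[OF m0] by auto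
    ultimately have "(\<lambda>x. row m k (x, a)) ` {..<m} = {..<m}" by (intro endo_inj_surj) auto
    then obtain x where x: "x < m" "row m k (x, a) = v mod m"
      using m0 by (metis (no_types, lifting) imageE lessThan_iff mod_less_divisor)
    have uniq: "y = x" if "y < m" "row m k (y, a) = v mod m" for y
      using inj_onD[OF rows_inj, of y x] that x by auto
    show ?thesis
    proof (rule ex1I[of _ "edge r m (x, a)"])
      show "edge r m (x, a) \<in> N \<and> v \<in> edge r m (x, a)" using a x v_in by auto
      show "A = edge r m (x, a)" if "A \<in> N \<and> v \<in> A" for A
        using that a v_in uniq by auto
    qed
  qed
  moreover have "N \<subseteq> translates r m S" using a unfolding translates_def by auto
  ultimately show "perfect_matching {..<r * m} (translates r m S) N"
    unfolding perfect_matching_def by auto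
qed

end

lemma translate_hypergraph_exists:
  assumes "translate_hypergraph r (n div r) M S"
  shows "(\<exists>F :: nat set set. linear_grid_triangle_free r {..<n} F \<and> card F = (n div r) * card S) \<and>
    (r dvd n \<longrightarrow> (\<exists>F :: nat set set. linear_grid_triangle_free r {..<n} F \<and> card F = (n div r) * card S \<and>
       decomposable_into_perfect_matchings {..<n} F \<and> regular_hypergraph {..<n} F))"
proof -
  interpret translate_hypergraph r "n div r" M S by fact
  have F: "linear_grid_triangle_free r {..<n} (translates r (n div r) S)"
    by (rule linear_grid_triangle_free) simp
  show ?thesis
  proof (intro conjI impI)
    show "\<exists>F :: nat set set. linear_grid_triangle_free r {..<n} F \<and> card F = (n div r) * card S"
      using F card_translates by blast
    assume "r dvd n"
    then have "decomposable_into_perfect_matchings {..<n} (translates r (n div r) S)"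
      using decomposable by simp
    then show "\<exists>F :: nat set set. linear_grid_triangle_free r {..<n} F \<and> card F = (n div r) * card S \<and>
       decomposable_into_perfect_matchings {..<n} F \<and> regular_hypergraph {..<n} F"
      using F card_translates regular_of_decomposable by blast
  qed
qed

section \<open>Counting edges\<close>

lemma half_quotient:
  assumes "0 < k" and "2 * k \<le> n"
  shows "real n / (2 * real k) \<le> real (n div k)"
proof -
  have "n < k * (n div k) + k"
    using assms(1) by (metis add.commute div_mult_mod_eq mod_less_divisor mult.commute nat_add_left_cancel_less)
  then have "n < 2 * (k * (n div k))" using assms by linarith
  then have "real n < real (2 * (k * (n div k)))" by (simp only: of_nat_less_iff)
  then show ?thesis using assms(1) by (simp add: field_simps)
qed

text \<open>
  Velocities below \<open>M = \<lfloor>m / 4r\<rfloor>\<close> with \<open>m = \<lfloor>n / r\<rfloor>\<close> lose only constant factors against \<open>n\<close>, which are absorbed into \<open>\<beta>\<close>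
  because \<open>\<surd>log n \<ge> 1\<close>. The factor \<open>1 / 8\<close> is the one which the thinning for \<open>r = 3\<close> produces.
\<close>

lemma hypergraphs_from_dense_sets:
  fixes r M0 :: nat and b e :: real
  assumes r: "3 \<le> r" and b: "0 < b" and e: "0 \<le> e" "e \<le> 1"
    and dense: "\<And>M. M0 \<le> M \<Longrightarrow> \<exists>S\<subseteq>{..<M}. convex_solution_free (Suc r) S \<and> (r = 3 \<longrightarrow> hexagon_free S) \<and>
           real M powr e * exp (- b * sqrt (ln (real M))) / 8 \<le> real (card S)"
  shows "\<exists>(n0::nat) (\<beta>::real). \<beta> > 0 \<and>
      (\<forall>n::nat. n \<ge> n0 \<longrightarrow>
         (\<exists>F :: nat set set. linear_grid_triangle_free r {..<n} F \<and>
            real (card F) > real n powr (1 + e) * exp (- \<beta> * sqrt (ln (real n)))) \<and>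
         (r dvd n \<longrightarrow>
           (\<exists>F :: nat set set. linear_grid_triangle_free r {..<n} F \<and>
              real (card F) > real n powr (1 + e) * exp (- \<beta> * sqrt (ln (real n))) \<and>
              decomposable_into_perfect_matchings {..<n} F \<and>
              regular_hypergraph {..<n} F)))"
proof -
  \<comment> \<open>\<open>K = 2r \<cdot> 16r\<^sup>2 \<cdot> 8\<close> collects the losses in \<open>m\<close>, in \<open>M\<close> and in the density; \<open>2K\<close> makes the inequality strict\<close>
  define K where "K = 256 * real r ^ 3"
  define \<beta> where "\<beta> = b + ln (2 * K)"
  define n0 where "n0 = 2 * r * (8 * r * Suc M0)"
  have "1 \<le> real r ^ 3" using r by (intro one_le_power) simp
  then have K1: "1 \<le> K" unfolding K_def by linarith
  then have lnK: "0 < ln (2 * K)" by (intro ln_gt_zero) auto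
  have "(\<exists>F :: nat set set. linear_grid_triangle_free r {..<n} F \<and>
            real (card F) > real n powr (1 + e) * exp (- \<beta> * sqrt (ln (real n)))) \<and>
         (r dvd n \<longrightarrow>
           (\<exists>F :: nat set set. linear_grid_triangle_free r {..<n} F \<and>
              real (card F) > real n powr (1 + e) * exp (- \<beta> * sqrt (ln (real n))) \<and>
              decomposable_into_perfect_matchings {..<n} F \<and>
              regular_hypergraph {..<n} F))" if n: "n0 \<le> n" for n
  proof -
    define m where "m = n div r"
    define M where "M = m div (4 * r)"
    have "2 * (8 * r * Suc M0) \<le> m"
      using div_le_mono[OF n, of r] r unfolding n0_def m_def by (simp add: mult.assoc)
    then have m_big: "8 * r * Suc M0 \<le> m" by simp
    have "2 * r * 1 \<le> 2 * r * (8 * r * Suc M0)" using r by (intro mult_le_mono2) simp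
    from order_trans[OF this n[unfolded n0_def]] have n_r: "2 * r \<le> n" by (simp only: mult_1_right)
    have "2 * Suc M0 \<le> M"
      using div_le_mono[OF m_big, of "4 * r"] r unfolding M_def by simp
    then have M: "M0 \<le> M" "1 \<le> M" by auto
    have m_pos: "0 < m" using m_big r by auto
    have m_r: "2 * (4 * r) \<le> m" using m_big by simp
    obtain S where S: "S \<subseteq> {..<M}" "convex_solution_free (Suc r) S" "r = 3 \<longrightarrow> hexagon_free S"
        "real M powr e * exp (- b * sqrt (ln (real M))) / 8 \<le> real (card S)"
      using dense[OF M(1)] by blast
    have "translate_hypergraph r m M S"
    proof
      show "4 * r * M \<le> m" unfolding M_def by simp
    qed (use r m_pos S in auto)
    note ex = translate_hypergraph_exists[OF this[unfolded m_def], folded m_def]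
    define s where "s = sqrt (ln (real n))"
    have "M \<le> m" "m \<le> n" unfolding M_def m_def by (rule div_le_dividend)+
    then have Mn: "M \<le> n" by simp
    have n3: "3 \<le> n" using n_r r by simp
    have "1 \<le> ln (real n)"
    proof -
      have "exp 1 \<le> real n" using exp_le n3 by linarith
      then show ?thesis using n3 by (simp add: ln_ge_iff)
    qed
    then have s1: "1 \<le> s" unfolding s_def by simp
    have sM: "sqrt (ln (real M)) \<le> s" unfolding s_def using M(2) Mn by simp
    have m_low: "real n / (2 * real r) \<le> real m"
      unfolding m_def using r n_r by (intro half_quotient) auto
    have M_low: "real m / (8 * real r) \<le> real M"
      using half_quotient[of "4 * r" m] r m_r unfolding M_def by simp
    have "real n / (16 * real r ^ 2) = real n / (2 * real r) / (8 * real r)"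
      by (simp add: power2_eq_square)
    also have "\<dots> \<le> real m / (8 * real r)" using m_low by (intro divide_right_mono) auto
    also have "\<dots> \<le> real M" by (rule M_low)
    finally have "real n / (16 * real r ^ 2) \<le> real M" .
    then have "(real n / (16 * real r ^ 2)) powr e \<le> real M powr e"
      using e by (intro powr_mono2) auto
    moreover have "real n powr e / (16 * real r ^ 2) \<le> (real n / (16 * real r ^ 2)) powr e"
    proof -
      have "1 \<le> real r ^ 2" using r by (intro one_le_power) simp
      then have "1 \<le> 16 * real r ^ 2" by linarith
      then have "(16 * real r ^ 2) powr e \<le> 16 * real r ^ 2"
        using powr_mono[of e 1 "16 * real r ^ 2"] e by simp
      then have "real n powr e / (16 * real r ^ 2) \<le> real n powr e / (16 * real r ^ 2) powr e"
        using r by (intro divide_left_mono) auto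
      then show ?thesis by (simp add: powr_divide)
    qed
    ultimately have M_powr: "real n powr e / (16 * real r ^ 2) \<le> real M powr e" by linarith
    have expM: "exp (- b * s) \<le> exp (- b * sqrt (ln (real M)))" using b sM by simp
    have "real n powr (1 + e) / K * exp (- b * s)
        = real n / (2 * real r) * (real n powr e / (16 * real r ^ 2) * exp (- b * s) / 8)"
      using n3 unfolding K_def by (simp add: powr_add power2_eq_square power3_eq_cube)
    also have "\<dots> \<le> real m * (real M powr e * exp (- b * sqrt (ln (real M))) / 8)"
      using m_low M_powr expM by (intro mult_mono divide_right_mono) auto
    also have "\<dots> \<le> real m * real (card S)" using S(4) by (intro mult_left_mono) auto
    finally have low: "real n powr (1 + e) / K * exp (- b * s) \<le> real (m * card S)" by simp
    have "ln (2 * K) * 1 \<le> ln (2 * K) * s" using lnK s1 by (intro mult_left_mono) auto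
    then have "exp (- (ln (2 * K) * s)) \<le> exp (- ln (2 * K))" by simp
    also have "exp (- ln (2 * K)) = 1 / (2 * K)" using K1 by (subst exp_minus, subst exp_ln) (auto simp: inverse_eq_divide)
    also have "1 / (2 * K) < 1 / K" using K1 by (simp add: field_simps)
    finally have "exp (- (ln (2 * K) * s)) < 1 / K" .
    then have "exp (- b * s) * exp (- (ln (2 * K) * s)) < exp (- b * s) * (1 / K)"
      by (intro mult_strict_left_mono) auto
    moreover have "exp (- \<beta> * s) = exp (- b * s) * exp (- (ln (2 * K) * s))"
      unfolding \<beta>_def by (simp add: exp_add[symmetric] algebra_simps)
    ultimately have "exp (- \<beta> * s) < exp (- b * s) * (1 / K)" by simp
    then have "real n powr (1 + e) * exp (- \<beta> * s) < real n powr (1 + e) * (exp (- b * s) * (1 / K))"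
      using n3 by (intro mult_strict_left_mono) auto
    also have "\<dots> \<le> real (m * card S)" using low by (simp add: mult.commute)
    finally have "real n powr (1 + e) * exp (- \<beta> * sqrt (ln (real n))) < real (m * card S)" unfolding s_def .
    then show ?thesis using ex by metis
  qed
  moreover have "0 < \<beta>" unfolding \<beta>_def using b lnK by simp
  ultimately show ?thesis by blast
qed

theorem theorem1p6:
  shows
    "(\<forall>r::nat. r \<ge> 4 \<longrightarrow>
       (\<exists>(n0::nat) (\<beta>::real). \<beta> > 0 \<and>
         (\<forall>n::nat. n \<ge> n0 \<longrightarrow>
           (\<exists>F :: nat set set. linear_grid_triangle_free r {..<n} F \<and>
              real (card F) > real n ^ 2 * exp (- \<beta> * sqrt (ln (real n)))) \<and>
           (r dvd n \<longrightarrow>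
             (\<exists>F :: nat set set. linear_grid_triangle_free r {..<n} F \<and>
                real (card F) > real n ^ 2 * exp (- \<beta> * sqrt (ln (real n))) \<and>
                decomposable_into_perfect_matchings {..<n} F \<and>
                regular_hypergraph {..<n} F)))))
     \<and>
     (\<exists>(n0::nat) (\<beta>::real). \<beta> > 0 \<and>
       (\<forall>n::nat. n \<ge> n0 \<longrightarrow>
         (\<exists>F :: nat set set. linear_grid_triangle_free 3 {..<n} F \<and>
            real (card F) > real n powr 1.6 * exp (- \<beta> * sqrt (ln (real n)))) \<and>
         (3 dvd n \<longrightarrow>
           (\<exists>F :: nat set set. linear_grid_triangle_free 3 {..<n} F \<and>
              real (card F) > real n powr 1.6 * exp (- \<beta> * sqrt (ln (real n))) \<and>
              decomposable_into_perfect_matchings {..<n} F \<and>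
              regular_hypergraph {..<n} F))))"
proof (intro conjI allI impI)
  fix r :: nat assume r: "4 \<le> r"
  obtain b M0 where b: "0 < b" and dense: "\<And>M. M0 \<le> M \<Longrightarrow> \<exists>S\<subseteq>{..<M}. convex_solution_free (Suc r) S \<and>
           real M * exp (- b * sqrt (ln (real M))) \<le> real (card S)"
    using dense_convex_solution_free_set[of "Suc r"] by blast
  have weaken: "real M powr 1 * exp (- b * sqrt (ln (real M))) / 8 \<le> z"
    if "real M * exp (- b * sqrt (ln (real M))) \<le> z" for M and z :: real
  proof -
    define y where "y = real M * exp (- b * sqrt (ln (real M)))"
    have "0 \<le> y" "y \<le> z" using that unfolding y_def by auto
    then have "y / 8 \<le> z" by linarith
    then show ?thesis unfolding y_def by simp
  qed
  have sq: "real n powr (1 + 1) = real n ^ 2" for n by simp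
  show "\<exists>(n0::nat) (\<beta>::real). \<beta> > 0 \<and>
         (\<forall>n::nat. n \<ge> n0 \<longrightarrow>
           (\<exists>F :: nat set set. linear_grid_triangle_free r {..<n} F \<and>
              real (card F) > real n ^ 2 * exp (- \<beta> * sqrt (ln (real n)))) \<and>
           (r dvd n \<longrightarrow>
             (\<exists>F :: nat set set. linear_grid_triangle_free r {..<n} F \<and>
                real (card F) > real n ^ 2 * exp (- \<beta> * sqrt (ln (real n))) \<and>
                decomposable_into_perfect_matchings {..<n} F \<and>
                regular_hypergraph {..<n} F)))"
    unfolding sq[symmetric]
  proof (rule hypergraphs_from_dense_sets[of r b 1 M0])
    fix M assume "M0 \<le> M"
    then obtain S where S: "S \<subseteq> {..<M}" "convex_solution_free (Suc r) S"
        "real M * exp (- b * sqrt (ln (real M))) \<le> real (card S)"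
      using dense by blast
    have "real M powr 1 * exp (- b * sqrt (ln (real M))) / 8 \<le> real (card S)"
      using weaken[OF S(3)] .
    then show "\<exists>S\<subseteq>{..<M}. convex_solution_free (Suc r) S \<and> (r = 3 \<longrightarrow> hexagon_free S) \<and>
           real M powr 1 * exp (- b * sqrt (ln (real M))) / 8 \<le> real (card S)"
      using S(1,2) r by (intro exI[of _ S]) auto
  qed (use r b in auto)
next
  obtain b M0 where b: "0 < b" and dense: "\<And>M. M0 \<le> M \<Longrightarrow> \<exists>S\<subseteq>{..<M}. convex_solution_free (Suc 3) S \<and>
           hexagon_free S \<and> real M powr (3/5) * exp (- b * sqrt (ln (real M))) / 8 \<le> real (card S)"
    using dense_hexagon_free_set[of "Suc 3"] by blast
  have ex: "(1.6 :: real) = 1 + 3 / 5" by simp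
  show "\<exists>(n0::nat) (\<beta>::real). \<beta> > 0 \<and>
       (\<forall>n::nat. n \<ge> n0 \<longrightarrow>
         (\<exists>F :: nat set set. linear_grid_triangle_free 3 {..<n} F \<and>
            real (card F) > real n powr 1.6 * exp (- \<beta> * sqrt (ln (real n)))) \<and>
         (3 dvd n \<longrightarrow>
           (\<exists>F :: nat set set. linear_grid_triangle_free 3 {..<n} F \<and>
              real (card F) > real n powr 1.6 * exp (- \<beta> * sqrt (ln (real n))) \<and>
              decomposable_into_perfect_matchings {..<n} F \<and>
              regular_hypergraph {..<n} F)))"
    unfolding ex
    by (rule hypergraphs_from_dense_sets[of 3 b "3/5" M0]) (use b dense in auto)
qed

end
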